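(* Let $D$ be a convex compact domain in the hyperbolic plane $\mathbb{H}$ whose boundary is either a geodesic polygon or $C^1$. Then the Liouville measure of the set $\mathcal{G}_D$ of geodesics intersecting $D$ is one half of the length of the boundary of $D$: $$\mu(\mathcal{G}_D)=\tfrac12 L(\partial D).$$
   Context: $\mathbb{H}$ is the hyperbolic plane (curvature $-1$), e.g. the upper half plane with metric $\mathrm{d}s^2=(\mathrm{d}x^2+\mathrm{d}y^2)/y^2$. $\mathcal{G}_{\mathbb{H}}$ is the set of (unoriented, complete) geodesics of $\mathbb{H}$, identified with unordered pairs of distinct points $\{u,v\}$ of $\partial\mathbb{H}=\mathbb{R}\cup\{\infty\}$. $\mu$ is the Liouville measure on $\mathcal{G}_{\mathbb{H}}$, the isometry-invariant measure normalized as $\mathrm{d}\mu=\frac{\mathrm{d}u\,\mathrm{d}v}{|u-v|^2}$; equivalently, on the set of geodesics crossing a given geodesic, $\mathrm{d}\mu=\frac12\sin\alpha\,\mathrm{d}l\,\mathrm{d}\alpha$, where $l$ is the arclength position of the crossing point and $\alpha\in(0,\pi)$ the crossing angle. A domain here is a set with nonempty interior. $L(\partial D)$ is the hyperbolic length of $\partial D$. *)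

theory Defs
  imports "HOL-Analysis.Analysis"
begin

definition upper_half_plane :: "complex set" where
  "upper_half_plane = {z. Im z > 0}"

text \<open>Ideal points are elements of \<open>real option\<close>, where \<open>None\<close> is the point at infinity.
  The complete geodesic with ideal endpoints \<open>a\<close> and \<open>b\<close> is the half circle or vertical
  half line orthogonal to the real axis at the finite endpoints.\<close>

fun geodesic_line :: "real option \<Rightarrow> real option \<Rightarrow> complex set" where
  "geodesic_line (Some u) (Some v) =
     {z \<in> upper_half_plane. cmod (z - of_real ((u + v) / 2)) = \<bar>u - v\<bar> / 2}"
| "geodesic_line (Some u) None = {z \<in> upper_half_plane. Re z = u}"
| "geodesic_line None (Some v) = {z \<in> upper_half_plane. Re z = v}"
| "geodesic_line None None = {}"

definition geodesics :: "complex set set" where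
  "geodesics = {geodesic_line a b | a b. a \<noteq> b}"

text \<open>On a half circle the real part is an injective coordinate, so it decides betweenness;
  on a vertical line the imaginary part does.\<close>

definition geodesic_segment :: "complex \<Rightarrow> complex \<Rightarrow> complex set" where
  "geodesic_segment z w = {p. \<exists>l\<in>geodesics. z \<in> l \<and> w \<in> l \<and> p \<in> l \<and>
      Re p \<in> closed_segment (Re z) (Re w) \<and>
      (Re z = Re w \<longrightarrow> Im p \<in> closed_segment (Im z) (Im w))}"

definition geodesically_convex :: "complex set \<Rightarrow> bool" where
  "geodesically_convex D \<longleftrightarrow> (\<forall>z\<in>D. \<forall>w\<in>D. geodesic_segment z w \<subseteq> D)"

text \<open>The Borel sets of the space of unordered pairs of distinct ideal points. The pairs of
  finite points form an open subset, whose complement, the pairs containing the point at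
  infinity, is a copy of the real line; a set is Borel iff both of its traces are.\<close>

definition geodesic_space :: "complex set measure" where
  "geodesic_space = sigma geodesics
     {A. A \<subseteq> geodesics \<and>
         {(u, v). u < v \<and> geodesic_line (Some u) (Some v) \<in> A} \<in> sets borel \<and>
         {u. geodesic_line (Some u) None \<in> A} \<in> sets borel}"

text \<open>Each unordered pair of finite endpoints is represented once, by \<open>u < v\<close>. The geodesics
  ending at infinity form a null set.\<close>

definition liouville :: "complex set measure" where
  "liouville =
     distr (density (restrict_space lborel {(u, v). u < v}) (\<lambda>(u, v). ennreal (1 / \<bar>u - v\<bar>\<^sup>2)))
       geodesic_space (\<lambda>(u, v). geodesic_line (Some u) (Some v))"

definition geodesics_meeting :: "complex set \<Rightarrow> complex set set" where
  "geodesics_meeting D = {l \<in> geodesics. l \<inter> D \<noteq> {}}"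

definition parametrizes_loop :: "(real \<Rightarrow> complex) \<Rightarrow> complex set \<Rightarrow> bool" where
  "parametrizes_loop \<gamma> C \<longleftrightarrow>
     valid_path \<gamma> \<and> simple_path \<gamma> \<and> pathfinish \<gamma> = pathstart \<gamma> \<and> path_image \<gamma> = C"

text \<open>A simple closed curve that is cut by finitely many points (the images of \<open>S\<close>) into arcs
  each of which lies on a geodesic.\<close>

definition geodesic_polygon :: "complex set \<Rightarrow> bool" where
  "geodesic_polygon C \<longleftrightarrow>
     (\<exists>\<gamma> S. parametrizes_loop \<gamma> C \<and> finite S \<and>
        (\<forall>a b. 0 \<le> a \<and> a \<le> b \<and> b \<le> 1 \<and> {a<..<b} \<inter> S = {} \<longrightarrow>
           (\<exists>l\<in>geodesics. \<gamma> ` {a..b} \<subseteq> l)))"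

text \<open>Periodicity makes the curve continuously differentiable at its base point as well, and
  the nonvanishing derivative excludes corners.\<close>

definition C1_loop :: "complex set \<Rightarrow> bool" where
  "C1_loop C \<longleftrightarrow>
     (\<exists>\<gamma>. parametrizes_loop \<gamma> C \<and> (\<forall>t. \<gamma> (t + 1) = \<gamma> t) \<and>
        \<gamma> C1_differentiable_on UNIV \<and> (\<forall>t. vector_derivative \<gamma> (at t) \<noteq> 0))"

text \<open>The length element of the hyperbolic metric is \<open>\<bar>dz\<bar> / Im z\<close>. A valid path is
  differentiable off a finite set, which does not affect the integral, and the length of a simple
  closed curve is independent of its parametrization.\<close>

definition has_hyperbolic_length :: "complex set \<Rightarrow> real \<Rightarrow> bool" where
  "has_hyperbolic_length C L \<longleftrightarrow>
     (\<exists>\<gamma>. parametrizes_loop \<gamma> C \<and>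
        ((\<lambda>t. norm (vector_derivative \<gamma> (at t)) / Im (\<gamma> t)) has_integral L) {0..1})"

definition hyperbolic_length :: "complex set \<Rightarrow> real" where
  "hyperbolic_length C = (THE L. has_hyperbolic_length C L)"

end

theory Submission
  imports Defs
begin

text \<open>
  Fix an ideal endpoint \<open>u\<close> and put \<open>g z = Re (1 / (z - u))\<close>. The geodesic from \<open>u\<close> to \<open>v\<close> is the
  level set \<open>g = 1 / (v - u)\<close>, and the density \<open>dv / (u - v)\<^sup>2\<close> is the Lebesgue measure in the
  coordinate \<open>1 / (v - u)\<close>. So the geodesics from \<open>u\<close> that meet \<open>D\<close> have measure \<open>max g - min g\<close> over
  \<open>D\<close>. By convexity each intermediate level of \<open>g\<close> meets the boundary at most twice, so this is half
  of the total variation of \<open>g\<close> along a parametrization \<open>\<gamma>\<close> of the boundary, that is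
  \<open>\<integral> \<bar>Re (\<gamma>' / (\<gamma> - u)\<^sup>2)\<bar> dt / 2\<close>. Integrating over \<open>u\<close> and exchanging the integrals, the integral
  over \<open>u\<close> at fixed \<open>t\<close> is \<open>2 \<bar>\<gamma>'\<bar> / Im \<gamma>\<close>, twice the hyperbolic length element. Since every geodesic
  is counted once from each of its endpoints, \<open>2 \<mu>(G\<^sub>D) = L\<close>.
\<close>

subsection \<open>Total variation of a unimodal loop\<close>

lemma has_integral_abs_deriv_mono:
  fixes f f' :: "real \<Rightarrow> real"
  assumes "a \<le> b" "finite S" "continuous_on {a..b} f"
    and der: "\<And>t. t \<in> {a..b} - S \<Longrightarrow> (f has_real_derivative f' t) (at t)"
    and mono: "mono_on {a..b} f"
  shows "((\<lambda>t. \<bar>f' t\<bar>) has_integral (f b - f a)) {a..b}"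
proof -
  have I: "(f' has_integral (f b - f a)) {a..b}"
  proof (rule fundamental_theorem_of_calculus_interior_strong[of S])
    fix x assume "x \<in> {a<..<b} - S"
    then show "(f has_vector_derivative f' x) (at x)"
      using der[of x] by (simp add: has_real_derivative_iff_has_vector_derivative)
  qed (use assms in auto)
  show ?thesis
  proof (rule has_integral_spike_finite[OF _ _ I])
    \<comment> \<open>Monotonicity on the interval fixes the sign of a two-sided derivative only at
      interior points, so the endpoints join the exceptional set.\<close>
    show "finite (S \<union> {a, b})" using assms by simp
    fix t assume t: "t \<in> {a..b} - (S \<union> {a, b})"
    then have "f' t \<ge> 0"
      using mono_on_imp_deriv_nonneg[OF mono der[of t]] by auto
    then show "\<bar>f' t\<bar> = f' t" by simp
  qed
qed

text \<open>If the loop were not monotone between a minimum at \<open>p\<close> and a maximum at \<open>q\<close>, some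
  intermediate level would be attained twice there and, by the intermediate value theorem, a third
  time on the way back.\<close>

lemma unimodal_loop_variation_aux:
  fixes f f' :: "real \<Rightarrow> real"
  assumes cont: "continuous_on {a..b} f" and S: "finite S"
    and der: "\<And>t. t \<in> {a..b} - S \<Longrightarrow> (f has_real_derivative f' t) (at t)"
    and loop: "f a = f b"
    and range: "f ` {a..b} \<subseteq> {f p..f q}"
    and pq: "a \<le> p" "p \<le> q" "q \<le> b"
    and levels: "\<And>r s t. a \<le> r \<Longrightarrow> r < s \<Longrightarrow> s < t \<Longrightarrow> t < b \<Longrightarrow> f r = f s \<Longrightarrow> f s = f t
                   \<Longrightarrow> f p < f r \<Longrightarrow> f r < f q \<Longrightarrow> False"
  shows "((\<lambda>t. \<bar>f' t\<bar>) has_integral 2 * (f q - f p)) {a..b}"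
proof -
  have sub: "continuous_on {x..y} f" if "a \<le> x" "y \<le> b" for x y
    using continuous_on_subset[OF cont] that by auto
  have up: "\<exists>t. x < t \<and> t < y \<and> f t = c" if xy: "a \<le> x" "x \<le> y" "y \<le> b" "f x < c" "c < f y" for x y c
  proof -
    obtain t where "x \<le> t" "t \<le> y" "f t = c"
      using IVT'[of f x c y] sub[of x y] xy by auto
    then show ?thesis using xy by (intro exI[of _ t]) (auto simp: order_less_le)
  qed
  have dn: "\<exists>t. x < t \<and> t < y \<and> f t = c" if xy: "a \<le> x" "x \<le> y" "y \<le> b" "c < f x" "f y < c" for x y c
  proof -
    obtain t where "x \<le> t" "t \<le> y" "f t = c"
      using IVT2'[of f y c x] sub[of x y] xy by auto
    then show ?thesis using xy by (intro exI[of _ t]) (auto simp: order_less_le)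
  qed
  have bnd: "f p \<le> f t" "f t \<le> f q" if "t \<in> {a..b}" for t
    using range that by (auto simp: image_subset_iff)
  have mono: "mono_on {p..q} f"
  proof (rule mono_onI, rule ccontr)
    fix s t assume st: "s \<in> {p..q}" "t \<in> {p..q}" "s \<le> t" "\<not> f s \<le> f t"
    then obtain c where c: "f t < c" "c < f s" using dense[of "f t" "f s"] by auto
    have c': "f p < c" "c < f q" using c bnd[of s] bnd[of t] st pq by auto
    obtain x where x: "p < x" "x < s" "f x = c" using up[of p s c] st pq c c' by auto
    obtain y where y: "s < y" "y < t" "f y = c" using dn[of s t c] st pq c c' by auto
    \<comment> \<open>The third point at level \<open>c\<close> is the base point itself, or lies on
      the descent from \<open>a\<close> to \<open>p\<close>, or, since \<open>f b = f a\<close>, on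
      the ascent or descent from \<open>q\<close> to \<open>b\<close>. The strict bound
      \<open>t < b\<close> in \<open>levels\<close> keeps the base point from counting
      twice.\<close>
    consider "f a = c" | "f a > c" | "f a < c" by linarith
    then show False
    proof cases
      case 1
      then have "a < x" using x pq by auto
      then show False using levels[of a x y] 1 x y c' st pq by auto
    next
      case 2
      obtain z where z: "a < z" "z < p" "f z = c" using dn[of a p c] 2 c' pq by auto
      show False using levels[of z x y] z x y c' st pq by auto
    next
      case 3
      obtain z where z: "q < z" "z < b" "f z = c" using dn[of q b c] 3 c' pq loop by auto
      show False using levels[of x y z] z x y c' st pq by auto
    qed
  qed
  \<comment> \<open>On the two outer arcs a failure of monotonicity again gives two points at level
    \<open>c\<close>; the third now lies on the rise from \<open>p\<close> to
    \<open>q\<close>.\<close>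
  have anti1: "mono_on {a..p} (\<lambda>t. - f t)"
  proof (rule mono_onI, rule ccontr)
    fix s t assume st: "s \<in> {a..p}" "t \<in> {a..p}" "s \<le> t" "\<not> - f s \<le> - f t"
    then obtain c where c: "f s < c" "c < f t" using dense[of "f s" "f t"] by auto
    have c': "f p < c" "c < f q" using c bnd[of s] bnd[of t] st pq by auto
    obtain x where x: "s < x" "x < t" "f x = c" using up[of s t c] st pq c c' by auto
    obtain y where y: "t < y" "y < p" "f y = c" using dn[of t p c] st pq c c' by auto
    obtain z where z: "p < z" "z < q" "f z = c" using up[of p q c] c' pq by auto
    show False using levels[of x y z] x y z c' st pq by auto
  qed
  have anti2: "mono_on {q..b} (\<lambda>t. - f t)"
  proof (rule mono_onI, rule ccontr)
    fix s t assume st: "s \<in> {q..b}" "t \<in> {q..b}" "s \<le> t" "\<not> - f s \<le> - f t"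
    then obtain c where c: "f s < c" "c < f t" using dense[of "f s" "f t"] by auto
    have c': "f p < c" "c < f q" using c bnd[of s] bnd[of t] st pq by auto
    obtain x where x: "q < x" "x < s" "f x = c" using dn[of q s c] st pq c c' by auto
    obtain y where y: "s < y" "y < t" "f y = c" using up[of s t c] st pq c c' by auto
    obtain z where z: "p < z" "z < q" "f z = c" using up[of p q c] c' pq by auto
    show False using levels[of z x y] x y z c' st pq by auto
  qed
  have der': "((\<lambda>t. - f t) has_real_derivative - f' t) (at t)" if "t \<in> {a..b} - S" for t
    using der[OF that] by (rule DERIV_minus)
  have 1: "((\<lambda>t. \<bar>- f' t\<bar>) has_integral (- f p - - f a)) {a..p}"
    by (rule has_integral_abs_deriv_mono[OF _ S _ _ anti1]) (use pq der' in \<open>auto intro!: continuous_on_minus sub\<close>)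
  have 2: "((\<lambda>t. \<bar>f' t\<bar>) has_integral (f q - f p)) {p..q}"
    by (rule has_integral_abs_deriv_mono[OF _ S _ _ mono]) (use pq der in \<open>auto intro!: sub\<close>)
  have 3: "((\<lambda>t. \<bar>- f' t\<bar>) has_integral (- f b - - f q)) {q..b}"
    by (rule has_integral_abs_deriv_mono[OF _ S _ _ anti2]) (use pq der' in \<open>auto intro!: continuous_on_minus sub\<close>)
  have 12: "((\<lambda>t. \<bar>f' t\<bar>) has_integral (- f p - - f a + (f q - f p))) {a..q}"
    by (rule has_integral_combine[OF _ _ _ 2]) (use pq 1 in auto)
  have "((\<lambda>t. \<bar>f' t\<bar>) has_integral (- f p - - f a + (f q - f p) + (- f b - - f q))) {a..b}"
    by (rule has_integral_combine[OF _ _ 12]) (use pq 3 in auto)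
  then show ?thesis using loop by (simp add: algebra_simps)
qed

text \<open>The extrema may be attained in either order along the interval. If the maximum comes
  first, passing to \<open>- f\<close> exchanges the two extrema and preserves the condition on
  levels.\<close>

lemma unimodal_loop_variation:
  fixes f f' :: "real \<Rightarrow> real"
  assumes cont: "continuous_on {a..b} f" and S: "finite S"
    and der: "\<And>t. t \<in> {a..b} - S \<Longrightarrow> (f has_real_derivative f' t) (at t)"
    and loop: "f a = f b"
    and img: "f ` {a..b} = {m..M}" and "m \<le> M"
    and levels: "\<And>r s t. a \<le> r \<Longrightarrow> r < s \<Longrightarrow> s < t \<Longrightarrow> t < b \<Longrightarrow> f r = f s \<Longrightarrow> f s = f t
                   \<Longrightarrow> m < f r \<Longrightarrow> f r < M \<Longrightarrow> False"
  shows "((\<lambda>t. \<bar>f' t\<bar>) has_integral 2 * (M - m)) {a..b}"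
proof -
  have "m \<in> f ` {a..b}" "M \<in> f ` {a..b}" using img \<open>m \<le> M\<close> by auto
  then obtain p q where p: "p \<in> {a..b}" "f p = m" and q: "q \<in> {a..b}" "f q = M" by blast
  show ?thesis
  proof (cases "p \<le> q")
    case True
    show ?thesis
      using unimodal_loop_variation_aux[OF cont S der loop, of p q] img levels p q True by auto
  next
    case False
    have "((\<lambda>t. \<bar>- f' t\<bar>) has_integral 2 * (- f p - - f q)) {a..b}"
    proof (rule unimodal_loop_variation_aux[of a b "\<lambda>t. - f t" S "\<lambda>t. - f' t" q p])
      fix r s t
      assume "a \<le> r" "r < s" "s < t" "t < b" "- f r = - f s" "- f s = - f t" "- f q < - f r" "- f r < - f p"
      then show False using levels[of r s t] p q by auto
    qed (use assms p q False in \<open>auto intro!: continuous_on_minus DERIV_minus\<close>)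
    then show ?thesis using p q by simp
  qed
qed

text \<open>The integrand is the absolute derivative of \<open>sin (2 * x + c) / 2\<close>, a loop
  over one full period that attains each intermediate level at most twice. Its variation is
  therefore twice the width of its range, whatever the phase \<open>c\<close>, and the zeros of the
  cosine need not be located.\<close>

lemma has_integral_abs_cos_period:
  "((\<lambda>x. \<bar>cos (2 * x + c)\<bar>) has_integral 2) {-(pi/2)..pi/2}"
proof -
  let ?f = "\<lambda>x. sin (2 * x + c) / 2"
  have "((\<lambda>x. \<bar>cos (2 * x + c)\<bar>) has_integral 2 * (1/2 - (-1/2))) {-(pi/2)..pi/2}"
  proof (rule unimodal_loop_variation[of _ _ ?f "{}"])
    show "continuous_on {-(pi/2)..pi/2} ?f" by (intro continuous_intros) auto
    show "(?f has_real_derivative cos (2 * t + c)) (at t)" for t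
      by (auto intro!: derivative_eq_intros)
    have "2 * (pi/2) + c = (2 * (-(pi/2)) + c) + 2 * pi" by simp
    then show loop: "?f (-(pi/2)) = ?f (pi/2)" by (metis sin_periodic)
    have hit: "\<exists>x\<in>{-(pi/2)..pi/2}. ?f x = sin y / 2" for y
    proof -
      \<comment> \<open>The least number of full turns that brings
        \<open>(y + 2 * pi * n - c) / 2\<close> to or beyond the left endpoint; by minimality it
        also stays below the right one.\<close>
      define n where "n = \<lceil>(c - pi - y) / (2 * pi)\<rceil>"
      have "(c - pi - y) / (2 * pi) \<le> n" "n < (c - pi - y) / (2 * pi) + 1" unfolding n_def by linarith+
      then have n: "c - pi - y \<le> n * (2 * pi)" "n * (2 * pi) < c - pi - y + 2 * pi"
        by (simp_all add: field_simps)
      let ?x = "(y + 2 * pi * n - c) / 2"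
      have "2 * ?x + c = y + 2 * pi * n" by (simp add: field_simps)
      then have "sin (2 * ?x + c) = sin y" using sin_cos_eq_iff by metis
      then show ?thesis using n by (intro bexI[of _ ?x]) (auto simp: field_simps)
    qed
    show "?f ` {-(pi/2)..pi/2} = {-1/2..1/2}"
    proof safe
      fix y :: real assume "y \<in> {-1/2..1/2}"
      then have "sin (arcsin (2 * y)) = 2 * y" by (intro sin_arcsin) auto
      then show "y \<in> ?f ` {-(pi/2)..pi/2}" using hit[of "arcsin (2 * y)"] by force
    qed (use abs_sin_le_one in \<open>auto simp: abs_le_iff intro: order_trans\<close>)
    fix r s t
    assume rst: "-(pi/2) \<le> r" "r < s" "s < t" "t < pi/2" and eq: "?f r = ?f s" "?f s = ?f t"
    \<comment> \<open>Equal sines and equal cosines would make \<open>y - x\<close> an integer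
      multiple of \<open>pi\<close>, while it lies strictly between \<open>0\<close> and
      \<open>pi\<close>. As a fixed sine leaves only two values for the cosine, three points at one
      level are impossible by pigeonhole.\<close>
    have neq: "cos (2 * x + c) \<noteq> cos (2 * y + c)"
      if xy: "-(pi/2) \<le> x" "x < y" "y < pi/2" "?f x = ?f y" for x y
    proof
      assume "cos (2 * x + c) = cos (2 * y + c)"
      then obtain n :: int where "2 * y + c = 2 * x + c + 2 * pi * n"
        using xy sin_cos_eq_iff[of "2 * y + c" "2 * x + c"] by auto
      then have n: "y - x = pi * n" by (simp add: field_simps)
      then have "pi * 0 < pi * n" "pi * n < pi * 1" using xy by linarith+
      then have "0 < real_of_int n" "real_of_int n < 1"
        using mult_less_cancel_left_pos[OF pi_gt_zero] by blast+
      then show False by simp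
    qed
    have sq: "cos (2 * x + c) = cos (2 * y + c) \<or> cos (2 * x + c) = - cos (2 * y + c)" if "?f x = ?f y" for x y
      using that by (simp add: cos_squared_eq flip: power2_eq_iff)
    show False
      using neq[of r s] neq[of s t] neq[of r t] sq[of r s] sq[of s t] sq[of r t] rst eq by auto
  qed auto
  then show ?thesis by simp
qed

subsection \<open>Convexity in the projective model\<close>

lemma orthogonal_complexE:
  fixes a d :: complex
  assumes "d \<noteq> 0" "a \<bullet> d = 0"
  obtains t where "a = t *\<^sub>R (\<i> * d)"
proof
  have "Re a * Re d + Im a * Im d = 0" using assms by (simp add: inner_complex_def)
  moreover have "(Re d)\<^sup>2 + (Im d)\<^sup>2 \<noteq> 0" using assms by (simp add: complex_eq_iff sum_power2_eq_zero_iff)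
  ultimately show "a = ((a \<bullet> (\<i> * d)) / (norm d)\<^sup>2) *\<^sub>R (\<i> * d)"
    apply (simp add: complex_eq_iff inner_complex_def cmod_power2 field_simps)
    apply (intro conjI)
    by algebra+
qed

text \<open>A supporting line of \<open>K\<close> at \<open>p2\<close> would contain the chord,
  but \<open>q\<close> and \<open>q'\<close> lie strictly on different sides of it.\<close>

lemma convex_line_through_boundary_aux:
  fixes K :: "complex set"
  assumes K: "convex K" and mem: "p1 \<in> K" "p2 \<in> K" "p3 \<in> K" and bd: "p2 \<notin> interior K"
    and seg: "p2 \<in> open_segment p1 p3"
    and line: "n \<bullet> p1 = k" "n \<bullet> p3 = k"
    and q: "q \<in> K" "n \<bullet> q < k" and q': "q' \<in> K" "k < n \<bullet> q'"
  shows False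
proof -
  \<comment> \<open>If \<open>K\<close> is flat, a point outside \<open>interior K\<close> may still
    be relatively interior; the line that contains \<open>K\<close> then serves as the supporting
    line.\<close>
  obtain a where a: "a \<noteq> 0" "\<And>y. y \<in> K \<Longrightarrow> a \<bullet> p2 \<le> a \<bullet> y"
  proof (cases "interior K = {}")
    case True
    then obtain a b where "a \<noteq> 0" "K \<subseteq> {x. a \<bullet> x = b}"
      using empty_interior_subset_hyperplane[OF K] by blast
    then show thesis using that[of a] mem by (auto simp: subset_iff)
  next
    case False
    then have "p2 \<notin> rel_interior K" using bd rel_interior_nonempty_interior by blast
    then show thesis using supporting_hyperplane_rel_boundary[OF K mem(2)] that by metis
  qed
  obtain s where s: "0 < s" "s < 1" "p2 = (1 - s) *\<^sub>R p1 + s *\<^sub>R p3" and ne: "p1 \<noteq> p3"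
    using seg by (auto simp: in_segment)
  have p2: "f \<bullet> p2 = (1 - s) * (f \<bullet> p1) + s * (f \<bullet> p3)" for f
    by (simp add: s inner_add_right)
  \<comment> \<open>A convex combination with positive weights of two nonnegative numbers vanishes,
    so both do: the supporting functional is constant along the chord.\<close>
  have "(1 - s) * (a \<bullet> p1 - a \<bullet> p2) + s * (a \<bullet> p3 - a \<bullet> p2) = 0"
    using p2[of a] by (simp add: algebra_simps)
  moreover have "0 \<le> (1 - s) * (a \<bullet> p1 - a \<bullet> p2)" "0 \<le> s * (a \<bullet> p3 - a \<bullet> p2)"
    using s a(2) mem by simp_all
  ultimately have "(1 - s) * (a \<bullet> p1 - a \<bullet> p2) = 0" "s * (a \<bullet> p3 - a \<bullet> p2) = 0" by linarith+
  then have "a \<bullet> p1 = a \<bullet> p2" "a \<bullet> p3 = a \<bullet> p2" using s by auto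
  then have ad: "a \<bullet> (p3 - p1) = 0" by (simp add: inner_diff_right)
  have nd: "n \<bullet> (p3 - p1) = 0" using line by (simp add: inner_diff_right)
  define e where "e = \<i> * (p3 - p1)"
  \<comment> \<open>Two normals to the same chord in the plane are proportional to \<open>e\<close>.
    Hence \<open>q\<close> and \<open>q'\<close> are strictly separated by the supporting line,
    which has all of \<open>K\<close> on one side.\<close>
  obtain t where t: "a = t *\<^sub>R e" using orthogonal_complexE[OF _ ad] ne unfolding e_def by auto
  obtain r where r: "n = r *\<^sub>R e" using orthogonal_complexE[OF _ nd] ne unfolding e_def by auto
  have "n \<bullet> p2 = k" using p2[of n] line by (simp add: algebra_simps)
  define X Y where "X = e \<bullet> q - e \<bullet> p2" and "Y = e \<bullet> q' - e \<bullet> p2"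
  have "r * X < 0" "0 < r * Y" using q q' \<open>n \<bullet> p2 = k\<close> by (auto simp: r X_def Y_def algebra_simps)
  moreover have "0 \<le> t * X" "0 \<le> t * Y" using a(2)[OF q(1)] a(2)[OF q'(1)] by (auto simp: t X_def Y_def algebra_simps)
  moreover have "t \<noteq> 0" using t a by auto
  ultimately show False
    by (auto simp: zero_le_mult_iff mult_less_0_iff zero_less_mult_iff)
qed

text \<open>Of three distinct collinear points one lies strictly between the other two, and the
  preceding lemma applies to that one.\<close>

lemma convex_line_through_boundary:
  fixes K :: "complex set"
  assumes K: "convex K" and mem: "P \<subseteq> K" and bd: "P \<inter> interior K = {}"
    and line: "\<And>p. p \<in> P \<Longrightarrow> n \<bullet> p = k"
    and q: "q \<in> K" "n \<bullet> q < k" and q': "q' \<in> K" "k < n \<bullet> q'"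
    and p: "p1 \<in> P" "p2 \<in> P" "p3 \<in> P" "p1 \<noteq> p2" "p2 \<noteq> p3" "p3 \<noteq> p1"
  shows False
proof -
  have n: "n \<noteq> 0" using q q' by auto
  have "collinear {p1, p2, p3}"
    unfolding collinear_def
  proof (intro exI[of _ "\<i> * n"] ballI)
    fix x y assume "x \<in> {p1, p2, p3}" "y \<in> {p1, p2, p3}"
    then have "n \<bullet> x = k" "n \<bullet> y = k" using line p by auto
    then have "(x - y) \<bullet> n = 0" by (simp add: inner_commute[of _ n] inner_diff_right)
    then show "\<exists>c. x - y = c *\<^sub>R (\<i> * n)" using orthogonal_complexE[OF n] by metis
  qed
  then consider "p1 \<in> open_segment p2 p3" | "p2 \<in> open_segment p3 p1" | "p3 \<in> open_segment p1 p2"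
    using p by (auto simp: collinear_between_cases between_mem_segment open_segment_def)
  then show False
    using convex_line_through_boundary_aux[OF K _ _ _ _ _ _ _ q q'] p mem bd line
    by cases (metis IntI empty_iff subsetD)+
qed

text \<open>The Klein model with the parabola \<open>Im = Re\<^sup>2\<close> as conic: the equation of a half circle or a
  vertical line is affine in \<open>Re z\<close> and \<open>\<bar>z\<bar>\<^sup>2\<close>, so geodesics become chords.\<close>

definition klein :: "complex \<Rightarrow> complex" where
  "klein z = Complex (Re z) ((cmod z)\<^sup>2)"

lemma Re_klein [simp]: "Re (klein z) = Re z" and Im_klein [simp]: "Im (klein z) = (Re z)\<^sup>2 + (Im z)\<^sup>2"
  by (simp_all add: klein_def cmod_power2)

lemma inj_on_klein: "inj_on klein upper_half_plane"
  by (auto simp: inj_on_def upper_half_plane_def complex_eq_iff)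

lemma open_upper_half_plane: "open upper_half_plane"
  unfolding upper_half_plane_def by (intro open_Collect_less continuous_intros)

text \<open>The squared distance to a real center is affine in the Klein coordinates. A center
  equidistant from \<open>z\<close> and \<open>w\<close> therefore has the same distance to every
  point whose Klein image is on the line through theirs.\<close>

lemma geodesic_through:
  assumes "Im z > 0" "Im w > 0" "Re z \<noteq> Re w"
  obtains u v where "u \<noteq> v"
    "\<And>p t. Im p > 0 \<Longrightarrow> klein p = (1 - t) *\<^sub>R klein z + t *\<^sub>R klein w \<Longrightarrow> p \<in> geodesic_line (Some u) (Some v)"
proof -
  \<comment> \<open>The point where the Euclidean perpendicular bisector of \<open>z\<close> and
    \<open>w\<close> meets the real axis.\<close>
  define c where "c = ((cmod w)\<^sup>2 - (cmod z)\<^sup>2) / (2 * (Re w - Re z))"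
  define R where "R = cmod (z - c)"
  have "z - c \<noteq> 0" using assms by (auto simp: complex_eq_iff)
  then have R: "R > 0" unfolding R_def by simp
  have sq: "(cmod (p - c))\<^sup>2 = Im (klein p) - 2 * c * Re (klein p) + c\<^sup>2" for p :: complex
    unfolding cmod_power2 by (simp add: power2_eq_square algebra_simps)
  have "2 * c * (Re w - Re z) = (cmod w)\<^sup>2 - (cmod z)\<^sup>2"
    using assms unfolding c_def by (simp add: divide_simps) (simp add: algebra_simps)
  then have w: "Im (klein w) - 2 * c * Re (klein w) = Im (klein z) - 2 * c * Re (klein z)"
    by (simp add: cmod_power2 algebra_simps)
  show thesis
  proof (rule that[of "c - R" "c + R"])
    fix p t assume p: "Im p > 0" "klein p = (1 - t) *\<^sub>R klein z + t *\<^sub>R klein w"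
    have "Im (klein p) - 2 * c * Re (klein p)
        = (1 - t) * (Im (klein z) - 2 * c * Re (klein z)) + t * (Im (klein w) - 2 * c * Re (klein w))"
      unfolding p(2) by (simp add: algebra_simps del: Re_klein Im_klein)
    then have "(cmod (p - c))\<^sup>2 = (cmod (z - c))\<^sup>2"
      unfolding sq w by (simp add: algebra_simps)
    then have "cmod (p - c) = R" by (simp add: R_def)
    then show "p \<in> geodesic_line (Some (c - R)) (Some (c + R))"
      using p R by (simp add: upper_half_plane_def)
  qed (use R in simp)
qed

text \<open>Each point of a chord between Klein images is pulled back to a point of the upper half
  plane, which turns out to lie on the geodesic segment and hence in \<open>D\<close>.\<close>

lemma convex_klein_image:
  assumes D: "D \<subseteq> upper_half_plane" "geodesically_convex D"
  shows "convex (klein ` D)"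
  unfolding convex_contains_segment
proof (intro ballI subsetI)
  fix a b r assume "a \<in> klein ` D" "b \<in> klein ` D" "r \<in> closed_segment a b"
  then obtain z w t where zw: "z \<in> D" "w \<in> D" and t: "0 \<le> t" "t \<le> 1"
    and r: "r = (1 - t) *\<^sub>R klein z + t *\<^sub>R klein w" by (auto simp: in_segment)
  have pos: "Im z > 0" "Im w > 0" using D zw by (auto simp: upper_half_plane_def)
  define A where "A = (1 - t) * Re z + t * Re w"
  \<comment> \<open>The squared height of the preimage of \<open>r\<close>: this is
    \<open>Im r - (Re r)\<^sup>2\<close>, rearranged into visibly nonnegative terms.\<close>
  define B where "B = (1 - t) * (Im z)\<^sup>2 + t * (Im w)\<^sup>2 + t * (1 - t) * (Re z - Re w)\<^sup>2"
  have "(1 - t) * (Im z)\<^sup>2 + t * (Im w)\<^sup>2 > 0"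
  proof (cases "t = 0")
    case False
    then have "t * (Im w)\<^sup>2 > 0" using t pos by simp
    then show ?thesis using t by (simp add: add_nonneg_pos)
  qed (use pos in simp)
  moreover have "t * (1 - t) * (Re z - Re w)\<^sup>2 \<ge> 0" using t by simp
  ultimately have B: "B > 0" unfolding B_def by linarith
  define p where "p = Complex A (sqrt B)"
  have kp: "klein p = r"
    using B unfolding p_def r
    by (simp add: complex_eq_iff A_def) (simp add: B_def power2_eq_square algebra_simps)
  have Rep: "Re p \<in> closed_segment (Re z) (Re w)"
    using t by (auto simp: p_def A_def in_segment)
  have Imp: "Im p > 0" using B by (simp add: p_def)
  have "p \<in> geodesic_segment z w"
  proof (cases "Re z = Re w")
    case True
    \<comment> \<open>On a vertical line the squared heights interpolate linearly along the chord,
      so the height stays between those of the endpoints.\<close>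
    have "min (Im z) (Im w) \<le> Im p \<and> Im p \<le> max (Im z) (Im w)"
    proof -
      have B': "B = (1 - t) * (Im z)\<^sup>2 + t * (Im w)\<^sup>2" using True by (simp add: B_def)
      define l where "l = min (Im z) (Im w)"
      define h where "h = max (Im z) (Im w)"
      have "l\<^sup>2 \<le> (Im z)\<^sup>2" "l\<^sup>2 \<le> (Im w)\<^sup>2" "(Im z)\<^sup>2 \<le> h\<^sup>2" "(Im w)\<^sup>2 \<le> h\<^sup>2" 
        using pos by (auto simp: l_def h_def intro!: power_mono)
      then have "(1 - t) * l\<^sup>2 + t * l\<^sup>2 \<le> B" "B \<le> (1 - t) * h\<^sup>2 + t * h\<^sup>2"
        unfolding B' using t by (auto intro!: add_mono mult_left_mono)
      then have "l\<^sup>2 \<le> B" "B \<le> h\<^sup>2" by (simp_all add: algebra_simps)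
      moreover have "l \<ge> 0" "h \<ge> 0" using pos by (auto simp: l_def h_def)
      ultimately have "l \<le> sqrt B" "sqrt B \<le> h" by (auto intro: real_le_rsqrt real_le_lsqrt)
      then show ?thesis by (simp add: p_def l_def h_def)
    qed
    then have Im: "Im p \<in> closed_segment (Im z) (Im w)"
      by (auto simp: closed_segment_eq_real_ivl min_def max_def split: if_splits)
    have "Re p = Re z" using Rep True by simp
    then have "{z, w, p} \<subseteq> geodesic_line (Some (Re z)) None"
      using True pos Imp by (auto simp: upper_half_plane_def)
    moreover have "geodesic_line (Some (Re z)) None \<in> geodesics" unfolding geodesics_def by blast
    ultimately show ?thesis unfolding geodesic_segment_def using Rep Im by blast
  next
    case False
    obtain u v where uv: "u \<noteq> v"
      "\<And>p t. Im p > 0 \<Longrightarrow> klein p = (1 - t) *\<^sub>R klein z + t *\<^sub>R klein w \<Longrightarrow> p \<in> geodesic_line (Some u) (Some v)"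
      using geodesic_through[OF pos False] by blast
    have "z \<in> geodesic_line (Some u) (Some v)" by (rule uv(2)[of _ 0]) (use pos in auto)
    moreover have "w \<in> geodesic_line (Some u) (Some v)" by (rule uv(2)[of _ 1]) (use pos in auto)
    moreover have "p \<in> geodesic_line (Some u) (Some v)" by (rule uv(2)[of _ t]) (use Imp kp r in auto)
    moreover have "geodesic_line (Some u) (Some v) \<in> geodesics"
      unfolding geodesics_def using uv(1) by blast
    ultimately show ?thesis unfolding geodesic_segment_def using Rep False by blast
  qed
  then have "p \<in> D" using D(2) zw unfolding geodesically_convex_def by blast
  then show "r \<in> klein ` D" using kp by blast
qed

text \<open>Continuity of \<open>klein\<close> makes the preimage of the interior open, and
  injectivity keeps that preimage inside \<open>D\<close>. Consequently frontier points of a closed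
  \<open>D\<close> are not sent into the interior of the Klein image.\<close>

lemma interior_klein_image:
  assumes D: "D \<subseteq> upper_half_plane" and p: "p \<in> D" "klein p \<in> interior (klein ` D)"
  shows "p \<in> interior D"
proof (rule interiorI)
  have "continuous_on upper_half_plane klein"
    unfolding klein_def Complex_eq by (intro continuous_intros)
  then show "open (upper_half_plane \<inter> klein -` interior (klein ` D))"
    by (intro continuous_open_preimage open_upper_half_plane open_interior)
  show "p \<in> upper_half_plane \<inter> klein -` interior (klein ` D)" using D p by auto
  show "upper_half_plane \<inter> klein -` interior (klein ` D) \<subseteq> D"
  proof
    fix z assume z: "z \<in> upper_half_plane \<inter> klein -` interior (klein ` D)"
    then obtain d where "d \<in> D" "klein z = klein d" using interior_subset by blast
    then show "z \<in> D" using z D inj_on_klein by (metis IntD1 inj_onD subsetD)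
  qed
qed

text \<open>The map \<open>z \<mapsto> 1 / (z - u)\<close> sends \<open>u\<close> to infinity, hence the geodesics ending at \<open>u\<close> to vertical
  lines: \<open>pencil u\<close> is a coordinate on this pencil of geodesics, and the one that ends at \<open>v\<close> has
  coordinate \<open>1 / (v - u)\<close>.\<close>

definition pencil :: "real \<Rightarrow> complex \<Rightarrow> real" where
  "pencil u z = Re (1 / (z - of_real u))"

lemma pencil_eq: "pencil u z = (Re z - u) / (cmod (z - of_real u))\<^sup>2"
  by (simp add: pencil_def Re_divide cmod_power2)

text \<open>Clearing the positive denominator of \<open>pencil u z - c\<close> leaves an affine
  function of \<open>klein z\<close>. Levels of \<open>pencil u\<close> thus become straight lines,
  and the sign of \<open>pencil u z - c\<close> tells the side.\<close>

lemma pencil_klein: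
  assumes "Im z > 0"
  shows "Complex (1 + 2 * u * c) (- c) \<bullet> klein z - (u + c * u\<^sup>2) = (cmod (z - of_real u))\<^sup>2 * (pencil u z - c)"
    and "(cmod (z - of_real u))\<^sup>2 > 0"
proof -
  show pos: "(cmod (z - of_real u))\<^sup>2 > 0" using assms by (auto simp: complex_eq_iff)
  have sq: "(cmod (z - of_real u))\<^sup>2 = (Re z - u)\<^sup>2 + (Im z)\<^sup>2" by (simp add: cmod_power2)
  have "(cmod (z - of_real u))\<^sup>2 * (pencil u z - c) = (Re z - u) - c * (cmod (z - of_real u))\<^sup>2"
    using pos by (simp add: pencil_eq field_simps)
  also have "\<dots> = Complex (1 + 2 * u * c) (- c) \<bullet> klein z - (u + c * u\<^sup>2)"
    unfolding sq by (simp add: inner_complex_def power2_eq_square algebra_simps)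
  finally show "Complex (1 + 2 * u * c) (- c) \<bullet> klein z - (u + c * u\<^sup>2) = (cmod (z - of_real u))\<^sup>2 * (pencil u z - c)"
    by simp
qed

text \<open>In the Klein model the level \<open>c\<close> is a line with points of a convex set
  strictly on both sides, witnessed by \<open>q\<close> and \<open>q'\<close>; such a line passes
  through at most two boundary points.\<close>

lemma pencil_level_frontier:
  assumes D: "D \<subseteq> upper_half_plane" "geodesically_convex D" "closed D"
    and P: "z1 \<in> frontier D" "z2 \<in> frontier D" "z3 \<in> frontier D" "z1 \<noteq> z2" "z2 \<noteq> z3" "z3 \<noteq> z1"
    and lev: "pencil u z1 = c" "pencil u z2 = c" "pencil u z3 = c"
    and q: "q \<in> D" "pencil u q < c" and q': "q' \<in> D" "c < pencil u q'"
  shows False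
proof -
  let ?n = "Complex (1 + 2 * u * c) (- c)" and ?k = "u + c * u\<^sup>2"
  let ?P = "klein ` {z1, z2, z3}"
  have fr: "z \<in> D \<and> z \<notin> interior D" if "z \<in> frontier D" for z
    using that D(3) by (auto simp: frontier_def)
  have pos: "Im z > 0" if "z \<in> D" for z using D that by (auto simp: upper_half_plane_def)
  have inj: "klein z \<noteq> klein w" if "z \<in> D" "w \<in> D" "z \<noteq> w" for z w
    using inj_on_klein D that by (metis inj_onD subsetD)
  show False
  proof (rule convex_line_through_boundary[OF convex_klein_image[OF D(1,2)], where P = ?P and n = ?n and k = ?k])
    show "?P \<subseteq> klein ` D" using P fr by auto
    show "?P \<inter> interior (klein ` D) = {}" using P fr interior_klein_image[OF D(1)] by blast
    show "?n \<bullet> p = ?k" if "p \<in> ?P" for p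
    proof -
      obtain z where "z \<in> {z1, z2, z3}" "p = klein z" using \<open>p \<in> ?P\<close> by blast
      then show ?thesis using pencil_klein(1)[of z u c] P fr pos lev by auto
    qed
    show "klein q \<in> klein ` D" "klein q' \<in> klein ` D" using q q' by auto
    show "?n \<bullet> klein q < ?k"
      using pencil_klein(1)[OF pos[OF q(1)], of u c] pencil_klein(2)[OF pos[OF q(1)], of u] q(2) mult_pos_neg[of "(cmod (q - of_real u))\<^sup>2" "pencil u q - c"] by linarith
    show "?k < ?n \<bullet> klein q'"
      using pencil_klein(1)[OF pos[OF q'(1)], of u c] pencil_klein(2)[OF pos[OF q'(1)], of u] q'(2) mult_pos_pos[of "(cmod (q' - of_real u))\<^sup>2" "pencil u q' - c"] by linarith
    show "klein z1 \<in> ?P" "klein z2 \<in> ?P" "klein z3 \<in> ?P" by auto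
    show "klein z1 \<noteq> klein z2" "klein z2 \<noteq> klein z3" "klein z3 \<noteq> klein z1"
      using inj P fr by auto
  qed
qed

subsection \<open>Integration along a pencil of geodesics\<close>

lemma has_integral_Diff_finite:
  fixes f :: "'a::euclidean_space \<Rightarrow> 'b::banach"
  assumes "finite T"
  shows "(f has_integral I) (S - T) \<longleftrightarrow> (f has_integral I) S"
  by (rule has_integral_spike_set_eq)
    (auto intro: negligible_subset[OF negligible_finite[OF assms]])

text \<open>The maximum principle for the real part of \<open>s / (z - u)\<close>: its complex
  derivative never vanishes, so no interior point is a local maximum. The values \<open>1\<close>
  and \<open>-1\<close> of \<open>s\<close> give the maximum and the minimum of
  \<open>pencil u\<close>.\<close>

lemma frontier_maximum:
  fixes s :: complex
  assumes D: "compact D" "D \<subseteq> upper_half_plane" and s: "s \<noteq> 0" and z: "z \<in> D"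
  shows "\<exists>w\<in>frontier D. Re (s / (z - of_real u)) \<le> Re (s / (w - of_real u))"
proof -
  have ne: "x - of_real u \<noteq> 0" if "x \<in> D" for x
    using D(2) that by (auto simp: upper_half_plane_def complex_eq_iff)
  have "continuous_on D (\<lambda>x. Re (s / (x - of_real u)))"
    by (intro continuous_intros) (use ne in auto)
  then obtain w where w: "w \<in> D" and max: "\<And>x. x \<in> D \<Longrightarrow> Re (s / (x - of_real u)) \<le> Re (s / (w - of_real u))"
    using continuous_attains_sup[OF D(1), of "\<lambda>x. Re (s / (x - of_real u))"] z by blast
  have "w \<notin> interior D"
  proof
    assume "w \<in> interior D"
    then obtain e where e: "e > 0" "ball w e \<subseteq> D" by (auto simp: mem_interior)
    \<comment> \<open>The direction is chosen so that the derivative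
      \<open>- s * h / (w - u)\<^sup>2\<close> along it equals \<open>-1\<close>, which is
      incompatible with a local maximum.\<close>
    define h where "h = (w - of_real u)\<^sup>2 / s"
    have h: "h \<noteq> 0" using ne[OF w] s by (simp add: h_def)
    let ?\<phi> = "\<lambda>t. s / (w + of_real t * h - of_real u)"
    have "((\<lambda>x. s / (w + x * h - of_real u)) has_field_derivative - 1) (at (of_real 0))"
      using ne[OF w] s by (auto intro!: derivative_eq_intros simp: h_def power2_eq_square)
    then have "(?\<phi> has_vector_derivative - 1) (at 0)"
      using field_vector_diff_chain_at[of of_real 1 0 "\<lambda>x. s / (w + x * h - of_real u)" "-1"]
        bounded_linear.has_vector_derivative[OF bounded_linear_of_real has_vector_derivative_id[of "at 0"]]
      by (simp add: o_def)
    from bounded_linear.has_vector_derivative[OF bounded_linear_Re this]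
    have d: "((\<lambda>t. Re (?\<phi> t)) has_real_derivative - 1) (at 0)"
      by (simp add: has_real_derivative_iff_has_vector_derivative)
    have "(- 1 :: real) = 0"
    proof (rule DERIV_local_max[OF d])
      show "0 < e / cmod h" using e h by simp
      show "\<forall>t. \<bar>0 - t\<bar> < e / cmod h \<longrightarrow> Re (?\<phi> t) \<le> Re (?\<phi> 0)"
      proof safe
        fix t :: real assume "\<bar>0 - t\<bar> < e / cmod h"
        then have "w + of_real t * h \<in> ball w e" using h by (simp add: dist_norm norm_mult field_simps)
        then show "Re (?\<phi> t) \<le> Re (?\<phi> 0)" using max e by auto
      qed
    qed
    then show False by simp
  qed
  then have "w \<in> frontier D" using w D(1) by (simp add: frontier_def compact_imp_closed)
  then show ?thesis using max z by blast
qed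

text \<open>Along the loop \<open>pencil u\<close> fills a compact interval by connectedness, and by
  the maximum principle the rest of \<open>D\<close> adds no further values. An intermediate level
  hit three times would contradict \<open>pencil_level_frontier\<close>.\<close>

lemma pencil_image_loop_variation:
  assumes D: "D \<subseteq> upper_half_plane" "geodesically_convex D" "compact D"
    and \<gamma>: "simple_path \<gamma>" "pathfinish \<gamma> = pathstart \<gamma>" "path_image \<gamma> = frontier D"
    and S: "finite S" and der: "\<And>t. t \<in> {0..1} - S \<Longrightarrow> (\<gamma> has_vector_derivative \<gamma>' t) (at t)"
  obtains m M where "m \<le> M" "pencil u ` D = {m..M}"
    "((\<lambda>t. \<bar>Re (\<gamma>' t / (\<gamma> t - of_real u)\<^sup>2)\<bar>) has_integral 2 * (M - m)) {0..1}"
proof -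
  let ?f = "\<lambda>t. pencil u (\<gamma> t)"
  have fr: "frontier D \<subseteq> D" using D(3) by (simp add: frontier_subset_compact)
  have \<gamma>D: "\<gamma> t \<in> D" "\<gamma> t \<in> frontier D" if "t \<in> {0..1}" for t
    using that \<gamma>(3) fr by (auto simp: path_image_def)
  have ne: "x - of_real u \<noteq> 0" if "x \<in> D" for x
    using D(1) that by (auto simp: upper_half_plane_def complex_eq_iff)
  have "continuous_on {0..1} \<gamma>" using \<gamma>(1) by (simp add: simple_path_def path_def)
  then have cont: "continuous_on {0..1} ?f"
    unfolding pencil_def by (intro continuous_intros) (use ne \<gamma>D in auto)
  then have "connected (?f ` {0..1})" "compact (?f ` {0..1})"
    by (auto intro: connected_continuous_image compact_continuous_image)
  then obtain m M where mM: "?f ` {0..1} = {m..M}" using connected_compact_interval_1 by blast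
  then have le: "m \<le> M" by (metis atLeastatMost_empty_iff image_is_empty zero_le_one)
  have img: "pencil u ` D = {m..M}"
  proof
    have "?f ` {0..1} \<subseteq> pencil u ` D" using \<gamma>D by auto
    then show "{m..M} \<subseteq> pencil u ` D" using mM by simp
    show "pencil u ` D \<subseteq> {m..M}"
    proof safe
      fix z assume z: "z \<in> D"
      have fm: "pencil u w \<in> {m..M}" if "w \<in> frontier D" for w
        using that mM \<gamma>(3) by (metis image_eqI imageE path_image_def)
      obtain w where "w \<in> frontier D" "pencil u z \<le> pencil u w"
        using frontier_maximum[OF D(3,1) _ z, of 1 u] by (auto simp: pencil_def)
      moreover obtain w' where "w' \<in> frontier D" "pencil u w' \<le> pencil u z"
        using frontier_maximum[OF D(3,1) _ z, of "-1" u] by (auto simp: pencil_def)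
      ultimately show "pencil u z \<in> {m..M}" using fm by fastforce
    qed
  qed
  have "((\<lambda>t. \<bar>- Re (\<gamma>' t / (\<gamma> t - of_real u)\<^sup>2)\<bar>) has_integral 2 * (M - m)) {0..1}"
  proof (rule unimodal_loop_variation[OF cont S _ _ mM le])
    fix t assume t: "t \<in> {0..1} - S"
    have nz: "\<gamma> t - of_real u \<noteq> 0" using ne \<gamma>D t by auto
    have "((\<lambda>z. 1 / (z - of_real u)) has_field_derivative - (1 / (\<gamma> t - of_real u)\<^sup>2)) (at (\<gamma> t))"
      using nz by (auto intro!: derivative_eq_intros simp: power2_eq_square)
    from bounded_linear.has_vector_derivative[OF bounded_linear_Re field_vector_diff_chain_at[OF der[OF t] this]]
    show "(?f has_real_derivative - Re (\<gamma>' t / (\<gamma> t - of_real u)\<^sup>2)) (at t)"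
      by (simp add: has_real_derivative_iff_has_vector_derivative pencil_def o_def)
  next
    show "?f 0 = ?f 1" using \<gamma>(2) by (simp add: pathfinish_def pathstart_def)
  next
    fix r s t :: real
    assume rst: "0 \<le> r" "r < s" "s < t" "t < 1" and eq: "?f r = ?f s" "?f s = ?f t"
      and lev: "m < ?f r" "?f r < M"
    obtain q q' where q: "q \<in> D" "pencil u q = m" and q': "q' \<in> D" "pencil u q' = M"
      using img le by (metis atLeastAtMost_iff imageE order_refl)
    \<comment> \<open>A simple loop is injective only once its final parameter is dropped, which
      matches the strict bound in the condition on levels.\<close>
    have inj: "\<gamma> x \<noteq> \<gamma> y" if "0 \<le> x" "x < y" "y < 1" for x y
      using \<gamma>(1) that unfolding simple_path_def loop_free_def by force
    have "\<gamma> r \<noteq> \<gamma> s" "\<gamma> s \<noteq> \<gamma> t" "\<gamma> r \<noteq> \<gamma> t" using inj[of r s] inj[of s t] inj[of r t] rst by simp_all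
    moreover have "\<gamma> r \<in> frontier D" "\<gamma> s \<in> frontier D" "\<gamma> t \<in> frontier D"
      using \<gamma>D(2) rst by simp_all
    moreover have "pencil u q < ?f r" "?f r < pencil u q'" using lev q q' by simp_all
    ultimately show False
      using pencil_level_frontier[OF D(1,2) compact_imp_closed[OF D(3)], of "\<gamma> r" "\<gamma> s" "\<gamma> t" u "?f r" q q'] 
        q(1) q'(1) eq by metis
  qed
  then show thesis using that le img by simp
qed

text \<open>Up to sign the density is the derivative of \<open>1 / (v - u)\<close>, so this change
  of variables turns the integral into the length of the interval of pencil coordinates.\<close>

lemma nn_integral_inverse_square_pencil:
  assumes "m \<le> M"
  shows "(\<integral>\<^sup>+v. ennreal (1 / (u - v)\<^sup>2) * indicator {v. v \<noteq> u \<and> 1 / (v - u) \<in> {m..M}} v \<partial>lborel) = ennreal (M - m)"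
proof -
  let ?S = "{v. v \<noteq> u \<and> 1 / (v - u) \<in> {m..M}}"
  let ?g = "\<lambda>v. 1 / (v - u)"
  have "?S \<in> sets borel" by measurable
  then have S: "?S \<in> sets lebesgue" by simp
  have der: "(?g has_field_derivative - (1 / (v - u)\<^sup>2)) (at v within ?S)" if "v \<in> ?S" for v
    using that by (auto intro!: derivative_eq_intros simp: power2_eq_square)
  have inj: "inj_on ?g ?S" by (auto simp: inj_on_def)
  \<comment> \<open>The coordinate \<open>0\<close> belongs to the geodesic from \<open>u\<close> to
    infinity and is attained by no finite \<open>v \<noteq> u\<close>; the condition
    \<open>v \<noteq> u\<close> also shuts out the default \<open>1 / 0 = 0\<close>.\<close>
  have gS: "?g ` ?S = {m..M} - {0}"
  proof safe
    fix y assume "y \<in> {m..M}" "y \<notin> ?g ` ?S"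
    moreover have "y \<in> ?g ` ?S" if "y \<noteq> 0"
      by (rule image_eqI[of _ _ "u + 1 / y"]) (use that \<open>y \<in> {m..M}\<close> in auto)
    ultimately show "y = 0" by blast
  qed auto
  have "((\<lambda>x. 1::real) has_integral (M - m)) {m..M}"
    using has_integral_const_real[of "1::real" m M] assms by simp
  then have I: "((\<lambda>x. 1::real) has_integral (M - m)) ({m..M} - {0})"
    by (rule has_integral_Diff_finite[THEN iffD2, rotated]) simp
  then have "(\<lambda>x. 1::real) absolutely_integrable_on (?g ` ?S)" "integral (?g ` ?S) (\<lambda>x. 1::real) = M - m"
    unfolding gS by (auto intro!: nonnegative_absolutely_integrable_1 simp: integral_unique has_integral_integrable)
  then have *: "(\<lambda>v. \<bar>- (1 / (v - u)\<^sup>2)\<bar> * 1) absolutely_integrable_on ?S \<and>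
      integral ?S (\<lambda>v. \<bar>- (1 / (v - u)\<^sup>2)\<bar> * 1) = M - m"
    using has_absolute_integral_change_of_variables_1'[OF S der inj, of "\<lambda>_. 1" "M - m"] by simp
  from integrable_integral[OF set_lebesgue_integral_eq_integral(1)[OF conjunct1[OF *]]] conjunct2[OF *]
  have "((\<lambda>v. \<bar>- (1 / (v - u)\<^sup>2)\<bar> * 1) has_integral (M - m)) ?S" by simp
  then have "((\<lambda>v. 1 / (u - v)\<^sup>2) has_integral (M - m)) ?S"
    by (simp add: power2_commute[of u])
  then show ?thesis by (intro nn_integral_has_integral_lebesgue') auto
qed

text \<open>The substitution \<open>u = x + y tan \<phi>\<close> parametrizes the pencil of geodesics through \<open>z\<close> by
  angle.\<close>

lemma abs_Re_divide_square_tan: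
  assumes "cos \<phi> > 0" and y: "y > 0" and z: "z = Complex x y"
  shows "\<bar>y / (cos \<phi>)\<^sup>2\<bar> * \<bar>Re (w / (z - of_real (x + y * tan \<phi>))\<^sup>2)\<bar> = cmod w / y * \<bar>cos (2 * \<phi> + - Arg w)\<bar>"
proof -
  let ?c = "complex_of_real (cos \<phi>)" and ?y = "complex_of_real y"
  have nz: "?c \<noteq> 0" "?y \<noteq> 0" using assms by auto
  \<comment> \<open>With this \<open>u\<close> the difference has argument
    \<open>\<phi> + pi / 2\<close> and modulus \<open>y / cos \<phi>\<close>. Squaring doubles the
    angle, and the Jacobian \<open>y / (cos \<phi>)\<^sup>2\<close> cancels the cosines in the
    modulus.\<close>
  have "z - of_real (x + y * tan \<phi>) = ?y * \<i> * cis \<phi> / ?c"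
    using assms by (simp add: z complex_eq_iff tan_def field_simps)
  then have "(z - of_real (x + y * tan \<phi>))\<^sup>2 = - (?y\<^sup>2 * cis (2 * \<phi>) / ?c\<^sup>2)"
    using Complex.DeMoivre[of \<phi> 2] by (simp add: power_mult_distrib power_divide)
  then have "w / (z - of_real (x + y * tan \<phi>))\<^sup>2 = - (w * cis (- (2 * \<phi>)) * ?c\<^sup>2 / ?y\<^sup>2)"
    by (simp add: cis_inverse[symmetric] field_simps)
  also have "w * cis (- (2 * \<phi>)) = of_real (cmod w) * cis (Arg w - 2 * \<phi>)"
  proof -
    have "w = of_real (cmod w) * cis (Arg w)" by (metis rcis_cmod_Arg rcis_def)
    then have "w * cis (- (2 * \<phi>)) = of_real (cmod w) * (cis (Arg w) * cis (- (2 * \<phi>)))"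
      by (metis mult.assoc)
    then show ?thesis by (simp add: cis_mult)
  qed
  finally have "w / (z - of_real (x + y * tan \<phi>))\<^sup>2
     = (- (cmod w * (cos \<phi>)\<^sup>2 / y\<^sup>2)) *\<^sub>R cis (Arg w - 2 * \<phi>)"
    by (simp add: scaleR_conv_of_real field_simps)
  then have "Re (w / (z - of_real (x + y * tan \<phi>))\<^sup>2) = - (cmod w * (cos \<phi>)\<^sup>2 / y\<^sup>2) * cos (Arg w - 2 * \<phi>)"
    by simp
  also have "cos (Arg w - 2 * \<phi>) = cos (2 * \<phi> + - Arg w)" using cos_minus[of "Arg w - 2 * \<phi>"] by simp
  finally have *: "Re (w / (z - of_real (x + y * tan \<phi>))\<^sup>2) = - (cmod w * (cos \<phi>)\<^sup>2 / y\<^sup>2) * cos (2 * \<phi> + - Arg w)" .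
  show ?thesis unfolding * using assms(1,2) by (simp add: abs_mult field_simps power2_eq_square)
qed

text \<open>In the angular coordinate the integrand is a constant times the absolute cosine over a
  full period. The direction of \<open>w\<close> enters only as a phase and disappears, which leaves
  twice the hyperbolic norm of \<open>w\<close> at \<open>z\<close>.\<close>

lemma nn_integral_abs_Re_divide_square:
  assumes z: "Im z > 0"
  shows "(\<integral>\<^sup>+u. ennreal \<bar>Re (w / (z - of_real u)\<^sup>2)\<bar> \<partial>lborel) = ennreal (2 * cmod w / Im z)"
proof -
  let ?x = "Re z" and ?y = "Im z"
  let ?S = "{-(pi/2)<..<pi/2}"
  let ?g = "\<lambda>\<phi>. ?x + ?y * tan \<phi>"
  let ?F = "\<lambda>u. \<bar>Re (w / (z - of_real u)\<^sup>2)\<bar>"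
  have cos: "cos \<phi> > 0" if "\<phi> \<in> ?S" for \<phi> using that by (intro cos_gt_zero_pi) auto
  have S: "?S \<in> sets lebesgue" by simp
  have der: "(?g has_field_derivative ?y / (cos \<phi>)\<^sup>2) (at \<phi> within ?S)" if "\<phi> \<in> ?S" for \<phi>
  proof -
    have "cos \<phi> \<noteq> 0" using cos[OF that] by simp
    then have "(?g has_field_derivative ?y * inverse ((cos \<phi>)\<^sup>2)) (at \<phi>)"
      by (auto intro!: derivative_eq_intros)
    then show ?thesis unfolding divide_inverse by (rule has_field_derivative_at_within)
  qed
  have inj: "inj_on ?g ?S"
  proof (rule inj_onI)
    fix a b assume "a \<in> ?S" "b \<in> ?S" "?g a = ?g b"
    then have "tan a = tan b" using z by simp
    moreover have "arctan (tan a) = a" "arctan (tan b) = b"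
      using \<open>a \<in> ?S\<close> \<open>b \<in> ?S\<close> by (auto intro!: arctan_tan)
    ultimately show "a = b" by metis
  qed
  have gS: "?g ` ?S = UNIV"
  proof -
    have "u \<in> ?g ` ?S" for u
    proof (rule image_eqI)
      let ?a = "arctan ((u - ?x) / ?y)"
      show "u = ?g ?a" using z by (simp only: tan_arctan) simp
      show "?a \<in> ?S" using arctan_lbound arctan_ubound by simp
    qed
    then show ?thesis by blast
  qed
  have "((\<lambda>\<phi>. cmod w / ?y * \<bar>cos (2 * \<phi> + - Arg w)\<bar>) has_integral (cmod w / ?y * 2)) {-(pi/2)..pi/2}"
    by (intro has_integral_mult_right has_integral_abs_cos_period)
  then have "((\<lambda>\<phi>. cmod w / ?y * \<bar>cos (2 * \<phi> + - Arg w)\<bar>) has_integral (cmod w / ?y * 2)) ({-(pi/2)..pi/2} - {-(pi/2), pi/2})"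
    by (rule has_integral_Diff_finite[THEN iffD2, rotated]) simp
  also have "{-(pi/2)..pi/2} - {-(pi/2), pi/2} = ?S" by auto
  finally have "((\<lambda>\<phi>. cmod w / ?y * \<bar>cos (2 * \<phi> + - Arg w)\<bar>) has_integral (cmod w / ?y * 2)) ?S" .
  then have "((\<lambda>\<phi>. \<bar>?y / (cos \<phi>)\<^sup>2\<bar> * ?F (?g \<phi>)) has_integral (cmod w / ?y * 2)) ?S"
    by (rule has_integral_eq[rotated])
      (rule abs_Re_divide_square_tan[symmetric], use cos z in simp_all)
  then have I1: "(\<lambda>\<phi>. \<bar>?y / (cos \<phi>)\<^sup>2\<bar> * ?F (?g \<phi>)) integrable_on ?S"
      and I2: "integral ?S (\<lambda>\<phi>. \<bar>?y / (cos \<phi>)\<^sup>2\<bar> * ?F (?g \<phi>)) = cmod w / ?y * 2"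
    by (rule has_integral_integrable, rule integral_unique)
  have "(\<lambda>\<phi>. \<bar>?y / (cos \<phi>)\<^sup>2\<bar> * ?F (?g \<phi>)) absolutely_integrable_on ?S"
    by (rule nonnegative_absolutely_integrable_1[OF I1]) simp
  with I2 have "(\<lambda>\<phi>. \<bar>?y / (cos \<phi>)\<^sup>2\<bar> * ?F (?g \<phi>)) absolutely_integrable_on ?S \<and>
      integral ?S (\<lambda>\<phi>. \<bar>?y / (cos \<phi>)\<^sup>2\<bar> * ?F (?g \<phi>)) = cmod w / ?y * 2"
    by (rule conjI[rotated])
  then have "?F absolutely_integrable_on (?g ` ?S) \<and> integral (?g ` ?S) ?F = cmod w / ?y * 2"
    using has_absolute_integral_change_of_variables_1'[of ?S ?g "\<lambda>\<phi>. ?y / (cos \<phi>)\<^sup>2" ?F "cmod w / ?y * 2", OF S der inj]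
    by (rule iffD1[rotated])
  then have *: "?F absolutely_integrable_on UNIV \<and> integral UNIV ?F = cmod w / ?y * 2"
    unfolding gS .
  from integrable_integral[OF set_lebesgue_integral_eq_integral(1)[OF conjunct1[OF *]]]
  have I: "(?F has_integral (cmod w / ?y * 2)) UNIV" unfolding conjunct2[OF *] .
  have "(\<lambda>u. w / (z - complex_of_real u)\<^sup>2) \<in> borel_measurable borel" by measurable
  then have "?F \<in> borel_measurable borel" by measurable
  from nn_integral_has_integral_lborel[OF this _ I] show ?thesis by (simp add: mult.commute)
qed

subsection \<open>The Liouville measure in terms of pencils\<close>

text \<open>Expanded around the endpoint \<open>u\<close>, the circle equation becomes
  \<open>(cmod (z - u))\<^sup>2 = (Re z - u) * (v - u)\<close>; division gives the pencil
  coordinate.\<close>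

lemma mem_geodesic_line_iff_pencil:
  assumes "Im z > 0" "u \<noteq> v"
  shows "z \<in> geodesic_line (Some u) (Some v) \<longleftrightarrow> 1 / (v - u) = pencil u z"
proof -
  have pos: "(Re z - u)\<^sup>2 + (Im z)\<^sup>2 > 0" using assms by (simp add: add_nonneg_pos)
  have "z \<in> geodesic_line (Some u) (Some v) \<longleftrightarrow> cmod (z - of_real ((u + v) / 2)) = \<bar>u - v\<bar> / 2"
    using assms by (simp add: upper_half_plane_def)
  also have "\<dots> \<longleftrightarrow> (cmod (z - of_real ((u + v) / 2)))\<^sup>2 = (\<bar>u - v\<bar> / 2)\<^sup>2"
    by (subst power2_eq_iff_nonneg) auto
  also have "\<dots> \<longleftrightarrow> (Re z - (u + v) / 2)\<^sup>2 + (Im z)\<^sup>2 = (u - v)\<^sup>2 / 4"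
    unfolding cmod_power2 by (simp add: power_divide)
  also have "\<dots> \<longleftrightarrow> (Re z - u)\<^sup>2 + (Im z)\<^sup>2 = (Re z - u) * (v - u)"
  proof -
    have "(Re z - (u + v) / 2)\<^sup>2 - (u - v)\<^sup>2 / 4 = (Re z - u)\<^sup>2 - (Re z - u) * (v - u)"
      by (simp add: power2_eq_square field_simps)
    then show ?thesis by (intro iffI; linarith)
  qed
  also have "\<dots> \<longleftrightarrow> 1 / (v - u) = pencil u z"
    using pos assms by (simp add: pencil_eq cmod_power2 divide_simps)
  finally show ?thesis .
qed

lemma geodesic_line_commute: "geodesic_line a b = geodesic_line b a"
  by (cases a; cases b) (auto simp: add.commute abs_minus_commute)

lemma geodesic_line_meets_iff:
  assumes "D \<subseteq> upper_half_plane" "u \<noteq> v"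
  shows "geodesic_line (Some u) (Some v) \<inter> D \<noteq> {} \<longleftrightarrow> 1 / (v - u) \<in> pencil u ` D"
  using mem_geodesic_line_iff_pencil[OF _ assms(2)] assms(1)
  by (fastforce simp: upper_half_plane_def)

text \<open>Incidence of a point with a half circle is a closed condition, and projection along the
  compact set \<open>D\<close> preserves closedness. Intersecting with the open set
  \<open>u < v\<close> stays Borel.\<close>

lemma borel_geodesic_lines_meeting:
  assumes D: "compact D" "D \<subseteq> upper_half_plane"
  shows "{(u, v). u < v \<and> geodesic_line (Some u) (Some v) \<inter> D \<noteq> {}} \<in> sets borel"
proof -
  let ?C = "{y :: real \<times> real. \<exists>z. z \<in> D \<and> (z, y) \<in> {p. cmod (fst p - of_real ((fst (snd p) + snd (snd p)) / 2)) = \<bar>fst (snd p) - snd (snd p)\<bar> / 2}}"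
  have "closed ?C"
    by (intro closed_compact_projection D closed_Collect_eq continuous_intros) simp_all
  moreover have "open {y :: real \<times> real. fst y < snd y}"
    by (intro open_Collect_less continuous_intros)
  moreover have "{(u, v). u < v \<and> geodesic_line (Some u) (Some v) \<inter> D \<noteq> {}} = {y. fst y < snd y} \<inter> ?C"
    using D(2) by (auto simp: disjoint_iff subset_iff)
  ultimately show ?thesis by simp
qed

text \<open>The generating family is already a sigma-algebra, because taking the two traces commutes
  with complements and countable unions.\<close>

lemma sets_geodesic_space:
  "sets geodesic_space = {A. A \<subseteq> geodesics \<and>
         {(u, v). u < v \<and> geodesic_line (Some u) (Some v) \<in> A} \<in> sets borel \<and>
         {u. geodesic_line (Some u) None \<in> A} \<in> sets borel}" (is "_ = ?M")
proof -
  have line: "geodesic_line (Some u) (Some v) \<in> geodesics" if "u < v" for u v :: real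
    using that unfolding geodesics_def by blast
  have vert: "geodesic_line (Some u) None \<in> geodesics" for u
    unfolding geodesics_def by blast
  have "sigma_algebra geodesics ?M"
    unfolding sigma_algebra_iff2
  proof (intro conjI ballI allI impI)
    show "?M \<subseteq> Pow geodesics" by blast
    show "{} \<in> ?M" by simp
  next
    fix A assume A: "A \<in> ?M"
    have "{(u, v). u < v \<and> geodesic_line (Some u) (Some v) \<in> geodesics - A}
        = {y. fst y < snd y} - {(u, v). u < v \<and> geodesic_line (Some u) (Some v) \<in> A}"
      using line by auto
    moreover have "{y :: real \<times> real. fst y < snd y} \<in> sets borel"
      by (intro borel_open open_Collect_less continuous_intros)
    moreover have "{u. geodesic_line (Some u) None \<in> geodesics - A} = - {u. geodesic_line (Some u) None \<in> A}"
      using vert by auto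
    ultimately show "geodesics - A \<in> ?M" using A by auto
  next
    fix A :: "nat \<Rightarrow> complex set set" assume A: "range A \<subseteq> ?M"
    have "{(u, v). u < v \<and> geodesic_line (Some u) (Some v) \<in> (\<Union>i. A i)}
        = (\<Union>i. {(u, v). u < v \<and> geodesic_line (Some u) (Some v) \<in> A i})" by auto
    moreover have "{u. geodesic_line (Some u) None \<in> (\<Union>i. A i)} = (\<Union>i. {u. geodesic_line (Some u) None \<in> A i})"
      by auto
    ultimately show "(\<Union>i. A i) \<in> ?M" using A by (auto simp: image_subset_iff intro!: sets.countable_UN)
  qed
  then show ?thesis
    unfolding geodesic_space_def by (rule sigma_algebra.sets_measure_of_eq)
qed

lemma space_geodesic_space: "space geodesic_space = geodesics"
  unfolding geodesic_space_def by (rule space_measure_of) blast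

text \<open>The trace on finite pairs is Borel by the projection argument; the trace at infinity is
  the image of \<open>D\<close> under \<open>Re\<close>, which is compact.\<close>

lemma geodesics_meeting_sets:
  assumes D: "compact D" "D \<subseteq> upper_half_plane"
  shows "geodesics_meeting D \<in> sets geodesic_space"
proof -
  have "{(u, v). u < v \<and> geodesic_line (Some u) (Some v) \<in> geodesics_meeting D}
      = {(u, v). u < v \<and> geodesic_line (Some u) (Some v) \<inter> D \<noteq> {}}"
    unfolding geodesics_meeting_def geodesics_def by blast
  moreover have "{u. geodesic_line (Some u) None \<in> geodesics_meeting D} = Re ` D"
    using D(2) unfolding geodesics_meeting_def geodesics_def by (force simp: disjoint_iff)
  moreover have "compact (Re ` D)"
    by (intro compact_continuous_image D continuous_intros)
  ultimately show ?thesis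
    using borel_geodesic_lines_meeting[OF D]
    by (auto simp: sets_geodesic_space geodesics_meeting_def compact_imp_closed)
qed

lemma measurable_geodesic_line:
  "(\<lambda>(u, v). geodesic_line (Some u) (Some v)) \<in> measurable (restrict_space lborel {(u, v). u < v}) geodesic_space"
proof (rule measurableI)
  fix x :: "real \<times> real" assume "x \<in> space (restrict_space lborel {(u, v). u < v})"
  then show "(case x of (u, v) \<Rightarrow> geodesic_line (Some u) (Some v)) \<in> space geodesic_space"
    by (auto simp: space_restrict_space space_geodesic_space geodesics_def simp del: geodesic_line.simps)
next
  fix A assume A: "A \<in> sets geodesic_space"
  have "(\<lambda>(u, v). geodesic_line (Some u) (Some v)) -` A \<inter> space (restrict_space lborel {(u, v). u < v})
      = {(u, v). u < v} \<inter> {(u, v). u < v \<and> geodesic_line (Some u) (Some v) \<in> A}"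
    by (auto simp: space_restrict_space simp del: geodesic_line.simps)
  also have "\<dots> \<in> sets (restrict_space lborel {(u, v). u < v})"
    using A by (simp add: sets_geodesic_space sets_restrict_space)
  finally show "(\<lambda>(u, v). geodesic_line (Some u) (Some v)) -` A \<inter> space (restrict_space lborel {(u, v). u < v})
      \<in> sets (restrict_space lborel {(u, v). u < v})" .
qed

lemma emeasure_liouville_geodesics_meeting:
  assumes D: "compact D" "D \<subseteq> upper_half_plane"
  defines "T \<equiv> {(u, v). u < v \<and> geodesic_line (Some u) (Some v) \<inter> D \<noteq> {}}"
  shows "emeasure liouville (geodesics_meeting D) =
    (\<integral>\<^sup>+u. \<integral>\<^sup>+v. ennreal (1 / (u - v)\<^sup>2) * indicator T (u, v) \<partial>lborel \<partial>lborel)"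
proof -
  let ?H = "{(u, v). u < v} :: (real \<times> real) set"
  let ?f = "\<lambda>(u, v). ennreal (1 / \<bar>u - v\<bar>\<^sup>2) :: ennreal"
  let ?R = "restrict_space lborel ?H"
  have H: "?H \<in> sets borel"
    unfolding case_prod_unfold by (intro borel_open open_Collect_less continuous_intros)
  have T: "T \<in> sets borel" unfolding T_def by (rule borel_geodesic_lines_meeting[OF D])
  have f: "?f \<in> borel_measurable (borel :: (real \<times> real) measure)"
    unfolding case_prod_unfold borel_prod[symmetric] by measurable
  have fR: "?f \<in> borel_measurable ?R"
    by (rule measurable_restrict_space1) (use f in simp)
  have pre: "(\<lambda>(u, v). geodesic_line (Some u) (Some v)) -` geodesics_meeting D \<inter> space (density ?R ?f) = T"
    by (auto simp: T_def space_restrict_space geodesics_meeting_def geodesics_def simp del: geodesic_line.simps)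
  have line: "(\<lambda>(u, v). geodesic_line (Some u) (Some v)) \<in> measurable (density ?R ?f) geodesic_space"
    unfolding measurable_cong_sets[OF sets_density refl] by (rule measurable_geodesic_line)
  have TR: "T \<in> sets ?R"
    using T by (auto simp: sets_restrict_space T_def intro!: image_eqI[of _ _ T])
  have "emeasure liouville (geodesics_meeting D) = emeasure (density ?R ?f) T"
    unfolding liouville_def emeasure_distr[OF line geodesics_meeting_sets[OF D]] pre ..
  also have "\<dots> = (\<integral>\<^sup>+x. ?f x * indicator T x \<partial>?R)"
    by (rule emeasure_density[OF fR TR])
  also have "\<dots> = (\<integral>\<^sup>+x. ?f x * indicator T x * indicator ?H x \<partial>lborel)"
    by (rule nn_integral_restrict_space) (use H in simp)
  also have "\<dots> = (\<integral>\<^sup>+x. ?f x * indicator T x \<partial>lborel)"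
    by (intro nn_integral_cong) (auto simp: T_def indicator_def)
  also have "\<dots> = (\<integral>\<^sup>+u. \<integral>\<^sup>+v. ?f (u, v) * indicator T (u, v) \<partial>lborel \<partial>lborel)"
    unfolding lborel_prod[symmetric]
    by (rule lborel.nn_integral_fst[symmetric])
      (use f T in \<open>auto simp: lborel_prod intro!: borel_measurable_times_ennreal borel_measurable_indicator\<close>)
  finally show ?thesis by simp
qed

text \<open>Adding the double integral over \<open>u < v\<close> to its transpose lets
  \<open>v\<close> range over both sides of \<open>u\<close>, so the inner integral runs over the
  whole pencil at \<open>u\<close>.\<close>

lemma emeasure_liouville_geodesics_meeting_doubled:
  assumes D: "compact D" "D \<subseteq> upper_half_plane"
  shows "2 * emeasure liouville (geodesics_meeting D) =
    (\<integral>\<^sup>+u. \<integral>\<^sup>+v. ennreal (1 / (u - v)\<^sup>2) * indicator {v. v \<noteq> u \<and> 1 / (v - u) \<in> pencil u ` D} v \<partial>lborel \<partial>lborel)"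
proof -
  define T where "T = {(u, v). u < v \<and> geodesic_line (Some u) (Some v) \<inter> D \<noteq> {}}"
  define h :: "real \<Rightarrow> real \<Rightarrow> ennreal" where "h u v = ennreal (1 / (u - v)\<^sup>2) * indicator T (u, v)" for u v
  have T[measurable]: "T \<in> sets (borel \<Otimes>\<^sub>M borel)"
    unfolding borel_prod T_def by (rule borel_geodesic_lines_meeting[OF D])
  have h[measurable]: "case_prod h \<in> borel_measurable (borel \<Otimes>\<^sub>M borel)"
    unfolding h_def by measurable
  have h': "case_prod h \<in> borel_measurable (lborel \<Otimes>\<^sub>M lborel)"
    using h by (simp cong: measurable_cong_sets)
  let ?\<mu> = "emeasure liouville (geodesics_meeting D)"
  have \<mu>: "?\<mu> = (\<integral>\<^sup>+u. \<integral>\<^sup>+v. h u v \<partial>lborel \<partial>lborel)"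
    unfolding emeasure_liouville_geodesics_meeting[OF D] h_def T_def ..
  also have "\<dots> = (\<integral>\<^sup>+u. \<integral>\<^sup>+v. h v u \<partial>lborel \<partial>lborel)"
    by (rule lborel_pair.Fubini'[OF h', symmetric])
  finally have \<mu>': "?\<mu> = (\<integral>\<^sup>+u. \<integral>\<^sup>+v. h v u \<partial>lborel \<partial>lborel)" .
  have "2 * ?\<mu> = (\<integral>\<^sup>+u. \<integral>\<^sup>+v. h u v \<partial>lborel \<partial>lborel) + (\<integral>\<^sup>+u. \<integral>\<^sup>+v. h v u \<partial>lborel \<partial>lborel)"
    using \<mu> \<mu>' by (simp add: mult_2)
  also have "\<dots> = (\<integral>\<^sup>+u. (\<integral>\<^sup>+v. h u v \<partial>lborel) + (\<integral>\<^sup>+v. h v u \<partial>lborel) \<partial>lborel)"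
    by (rule nn_integral_add[symmetric]) measurable
  also have "\<dots> = (\<integral>\<^sup>+u. \<integral>\<^sup>+v. h u v + h v u \<partial>lborel \<partial>lborel)"
    by (intro nn_integral_cong nn_integral_add[symmetric]) measurable
  also have "\<dots> = (\<integral>\<^sup>+u. \<integral>\<^sup>+v. ennreal (1 / (u - v)\<^sup>2) * indicator {v. v \<noteq> u \<and> 1 / (v - u) \<in> pencil u ` D} v \<partial>lborel \<partial>lborel)"
  proof (intro nn_integral_cong)
    fix u v :: real
    consider "u = v" | "u < v" | "v < u" by linarith
    then show "h u v + h v u = ennreal (1 / (u - v)\<^sup>2) * indicator {v. v \<noteq> u \<and> 1 / (v - u) \<in> pencil u ` D} v"
    proof cases
      case 1
      then show ?thesis by (simp add: h_def T_def del: geodesic_line.simps)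
    next
      case 2
      then have "(u, v) \<in> T \<longleftrightarrow> 1 / (v - u) \<in> pencil u ` D" "(v, u) \<notin> T"
        using geodesic_line_meets_iff[OF D(2), of u v] by (simp_all add: T_def del: geodesic_line.simps)
      then show ?thesis using 2 by (simp add: h_def indicator_def)
    next
      case 3
      then have "(v, u) \<in> T \<longleftrightarrow> 1 / (v - u) \<in> pencil u ` D" "(u, v) \<notin> T"
        using geodesic_line_meets_iff[OF D(2), of u v]
        by (simp_all add: T_def geodesic_line_commute[of "Some v" "Some u"] del: geodesic_line.simps)
      moreover have "(v - u)\<^sup>2 = (u - v)\<^sup>2" by (rule power2_commute)
      ultimately show ?thesis using 3 by (simp add: h_def indicator_def)
    qed
  qed
  finally show ?thesis .
qed

subsection \<open>The Crofton formula for convex loops\<close>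

text \<open>In \<open>(w - z) / ((z - u) * (w - u))\<close> the numerator is bounded, and both
  factors below dominate a multiple of \<open>\<i> - u\<close> uniformly in \<open>u\<close>, since
  \<open>D\<close> is bounded and stays away from the real axis. The oscillation of
  \<open>pencil u\<close> on \<open>D\<close> thus decays like
  \<open>1 / (1 + u\<^sup>2)\<close>.\<close>

lemma pencil_diff_bound:
  assumes D: "compact D" "D \<subseteq> upper_half_plane" "D \<noteq> {}"
  obtains C where "C \<ge> 0"
    "\<And>u z w. z \<in> D \<Longrightarrow> w \<in> D \<Longrightarrow> pencil u z - pencil u w \<le> C / (cmod (\<i> - of_real u))\<^sup>2"
proof -
  have "continuous_on D Im" by (intro continuous_intros)
  then obtain z0 where z0: "z0 \<in> D" "\<And>z. z \<in> D \<Longrightarrow> Im z0 \<le> Im z"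
    using continuous_attains_inf[OF D(1,3), of Im] by blast
  define \<delta> where "\<delta> = Im z0"
  have \<delta>: "\<delta> > 0" "\<And>z. z \<in> D \<Longrightarrow> \<delta> \<le> Im z"
    using z0 D(2) by (auto simp: \<delta>_def upper_half_plane_def)
  obtain R where R: "R > 0" "\<And>z. z \<in> D \<Longrightarrow> cmod z \<le> R"
    using compact_imp_bounded[OF D(1)] by (auto simp: bounded_pos)
  \<comment> \<open>The triangle inequality through \<open>z\<close> bounds
    \<open>cmod (\<i> - u)\<close> by \<open>1 + R\<close> plus \<open>cmod (z - u)\<close>, and
    \<open>1 + R\<close> is at most \<open>(1 + R) / \<delta>\<close> times
    \<open>cmod (z - u)\<close>.\<close>
  define k where "k = (1 + R) / \<delta> + 1"
  have k: "cmod (\<i> - of_real u) \<le> k * cmod (z - of_real u)" if z: "z \<in> D" for u z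
  proof -
    have "\<delta> \<le> cmod (z - of_real u)"
      using \<delta>(2)[OF z] abs_Im_le_cmod[of "z - of_real u"] by simp
    then have "(1 + R) / \<delta> * \<delta> \<le> (1 + R) / \<delta> * cmod (z - of_real u)"
      using R \<delta> by (intro mult_left_mono) auto
    then have "1 + R \<le> (1 + R) / \<delta> * cmod (z - of_real u)" using \<delta> by simp
    moreover have "cmod (\<i> - z) \<le> 1 + R"
      using norm_triangle_ineq4[of \<i> z] R(2)[OF z] by simp
    moreover have "cmod (\<i> - of_real u) \<le> cmod (\<i> - z) + cmod (z - of_real u)"
      using norm_triangle_ineq[of "\<i> - z" "z - of_real u"] by simp
    ultimately show ?thesis unfolding k_def distrib_right by linarith
  qed
  show thesis
  proof (rule that[of "2 * R * k\<^sup>2"])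
    show "0 \<le> 2 * R * k\<^sup>2" using R by simp
    fix u z w assume zw: "z \<in> D" "w \<in> D"
    let ?n = "cmod (\<i> - of_real u)" and ?z = "cmod (z - of_real u)" and ?w = "cmod (w - of_real u)"
    have nz: "z - of_real u \<noteq> 0" "w - of_real u \<noteq> 0" "\<i> - of_real u \<noteq> 0"
      using D(2) zw by (auto simp: upper_half_plane_def complex_eq_iff)
    have "?n * ?n \<le> (k * ?z) * (k * ?w)"
      using k[OF zw(1), of u] k[OF zw(2), of u] by (intro mult_mono) (auto intro: order_trans[of 0 ?n])
    then have n: "?n\<^sup>2 \<le> k\<^sup>2 * (?z * ?w)" by (simp add: power2_eq_square algebra_simps)
    have "pencil u z - pencil u w = Re (1 / (z - of_real u) - 1 / (w - of_real u))"
      by (simp add: pencil_def)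
    also have "\<dots> \<le> cmod (1 / (z - of_real u) - 1 / (w - of_real u))" by (rule complex_Re_le_cmod)
    also have "1 / (z - of_real u) - 1 / (w - of_real u) = (w - z) / ((z - of_real u) * (w - of_real u))"
      using nz by (simp add: field_simps)
    also have "cmod \<dots> = cmod (w - z) / (?z * ?w)" by (simp add: norm_divide norm_mult)
    also have "\<dots> \<le> 2 * R / (?z * ?w)"
      using norm_triangle_ineq4[of w z] R(2)[OF zw(1)] R(2)[OF zw(2)]
      by (intro divide_right_mono) auto
    also have "\<dots> \<le> 2 * R * k\<^sup>2 / ?n\<^sup>2"
    proof -
      have "2 * R * ?n\<^sup>2 \<le> 2 * R * (k\<^sup>2 * (?z * ?w))"
        using n R by (intro mult_left_mono) auto
      then show ?thesis using nz by (simp add: divide_simps mult_ac)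
    qed
    finally show "pencil u z - pencil u w \<le> 2 * R * k\<^sup>2 / ?n\<^sup>2" .
  qed
qed

text \<open>The decay \<open>1 / (cmod (\<i> - u))\<^sup>2\<close> is at most the sum of the
  absolute real and imaginary parts of \<open>1 / (\<i> - u)\<^sup>2\<close>. Their integrals are
  the case \<open>z = \<i>\<close> of \<open>nn_integral_abs_Re_divide_square\<close> with
  \<open>w = 1\<close> and \<open>w = \<i>\<close>.\<close>

lemma nn_integral_pencil_width_finite:
  assumes D: "compact D" "D \<subseteq> upper_half_plane"
    and mM: "\<And>u. m u \<le> M u" "\<And>u. pencil u ` D = {m u..M u}"
  shows "(\<integral>\<^sup>+u. ennreal (M u - m u) \<partial>lborel) < \<infinity>"
proof -
  have "D \<noteq> {}" using mM[of 0] by auto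
  then obtain C where C: "C \<ge> 0"
    "\<And>u z w. z \<in> D \<Longrightarrow> w \<in> D \<Longrightarrow> pencil u z - pencil u w \<le> C / (cmod (\<i> - of_real u))\<^sup>2"
    using pencil_diff_bound[OF D] by blast
  let ?r = "\<lambda>a u. \<bar>Re (a / (\<i> - complex_of_real u)\<^sup>2)\<bar>"
  have bound: "M u - m u \<le> C * (?r 1 u + ?r \<i> u)" for u
  proof -
    let ?x = "1 / (\<i> - complex_of_real u)\<^sup>2"
    obtain z w where "z \<in> D" "w \<in> D" "pencil u z = M u" "pencil u w = m u"
      using mM[of u] by (metis atLeastAtMost_iff imageE order_refl)
    then have "M u - m u \<le> C * cmod ?x"
      using C(2)[of z w u] by (simp add: norm_divide norm_power)
    also have "\<dots> \<le> C * (\<bar>Re ?x\<bar> + \<bar>Im ?x\<bar>)"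
      using C(1) cmod_le by (intro mult_left_mono) auto
    also have "\<bar>Im ?x\<bar> = ?r \<i> u"
    proof -
      have "\<i> / (\<i> - complex_of_real u)\<^sup>2 = \<i> * ?x" by simp
      then show ?thesis by (metis abs_minus_cancel Re_i_times)
    qed
    finally show ?thesis .
  qed
  have meas: "?r a \<in> borel_measurable lborel" for a by measurable
  have "(\<integral>\<^sup>+u. ennreal (M u - m u) \<partial>lborel) \<le> (\<integral>\<^sup>+u. ennreal C * (ennreal (?r 1 u) + ennreal (?r \<i> u)) \<partial>lborel)"
    using bound C(1) by (intro nn_integral_mono) (simp add: ennreal_mult'[symmetric] ennreal_plus[symmetric] ennreal_leI del: ennreal_plus)
  also have "\<dots> = ennreal C * ((\<integral>\<^sup>+u. ennreal (?r 1 u) \<partial>lborel) + (\<integral>\<^sup>+u. ennreal (?r \<i> u) \<partial>lborel))"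
    using meas by (simp add: nn_integral_cmult nn_integral_add)
  also have "\<dots> < \<infinity>"
    using nn_integral_abs_Re_divide_square[of \<i> 1] nn_integral_abs_Re_divide_square[of \<i> \<i>]
    by (simp add: ennreal_mult_less_top)
  finally show ?thesis .
qed

text \<open>Valid for every parametrization, this also gives the independence of the parametrization that
  makes the definite description in \<open>hyperbolic_length\<close> meaningful.\<close>

lemma crofton_convex_loop:
  assumes D: "D \<subseteq> upper_half_plane" "geodesically_convex D" "compact D"
    and \<gamma>: "parametrizes_loop \<gamma> (frontier D)"
  obtains L where "L \<ge> 0" "emeasure liouville (geodesics_meeting D) = ennreal (L / 2)"
    "((\<lambda>t. norm (vector_derivative \<gamma> (at t)) / Im (\<gamma> t)) has_integral L) {0..1}"
proof -
  have loop: "simple_path \<gamma>" "pathfinish \<gamma> = pathstart \<gamma>" "path_image \<gamma> = frontier D"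
    and valid: "valid_path \<gamma>" using \<gamma> by (auto simp: parametrizes_loop_def)
  obtain S where S: "finite S" "\<gamma> C1_differentiable_on ({0..1} - S)" and cont\<gamma>: "continuous_on {0..1} \<gamma>"
    using valid unfolding valid_path_def piecewise_C1_differentiable_on_def by blast
  define A where "A = {0..1} - S"
  define \<gamma>' where "\<gamma>' t = vector_derivative \<gamma> (at t)" for t
  have der: "(\<gamma> has_vector_derivative \<gamma>' t) (at t)" if "t \<in> {0..1} - S" for t
    using S(2) that vector_derivative_works unfolding C1_differentiable_on_eq \<gamma>'_def by blast
  have A: "A \<in> sets borel" unfolding A_def using S(1) by (simp add: finite_imp_closed)
  have cA: "continuous_on A \<gamma>'"
    using S(2) unfolding C1_differentiable_on_eq A_def \<gamma>'_def[abs_def] by blast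
  \<comment> \<open>Extension by zero makes velocity and position Borel on the whole line, as
    Tonelli's theorem requires. Off \<open>A\<close> the factor \<open>d\<close> vanishes, so the
    value of \<open>p\<close> there is harmless.\<close>
  define d where "d t = indicat_real A t *\<^sub>R \<gamma>' t" for t
  define p where "p t = indicat_real {0..1} t *\<^sub>R \<gamma> t" for t
  have d[measurable]: "d \<in> borel_measurable borel"
    unfolding d_def[abs_def] by (rule borel_measurable_continuous_on_indicator[OF A cA])
  have p[measurable]: "p \<in> borel_measurable borel"
    unfolding p_def[abs_def] by (rule borel_measurable_continuous_on_indicator[OF _ cont\<gamma>]) simp
  have pos: "Im (\<gamma> t) > 0" if "t \<in> {0..1}" for t
    using that loop(3) D(1) frontier_subset_compact[OF D(3)]
    by (force simp: path_image_def upper_half_plane_def)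
  have dp: "d t = 0" if "t \<notin> A" for t using that by (simp add: d_def)
  have dp': "d t = \<gamma>' t" "p t = \<gamma> t" "Im (p t) > 0" if "t \<in> A" for t
    using that pos by (auto simp: d_def p_def A_def)
  \<comment> \<open>Infimum and supremum turn the endpoints of the interval, known only to exist for
    each \<open>u\<close>, into functions of \<open>u\<close>.\<close>
  define m where "m u = Inf (pencil u ` D)" for u
  define M where "M u = Sup (pencil u ` D)" for u
  have mM: "m u \<le> M u" "pencil u ` D = {m u..M u}"
    "((\<lambda>t. \<bar>Re (\<gamma>' t / (\<gamma> t - of_real u)\<^sup>2)\<bar>) has_integral 2 * (M u - m u)) {0..1}" for u
  proof -
    obtain a b where ab: "a \<le> b" "pencil u ` D = {a..b}"
      "((\<lambda>t. \<bar>Re (\<gamma>' t / (\<gamma> t - of_real u)\<^sup>2)\<bar>) has_integral 2 * (b - a)) {0..1}"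
      by (rule pencil_image_loop_variation[OF D loop S(1) der])
    then have "m u = a" "M u = b" by (simp_all add: m_def M_def)
    with ab show "m u \<le> M u" "pencil u ` D = {m u..M u}"
      "((\<lambda>t. \<bar>Re (\<gamma>' t / (\<gamma> t - of_real u)\<^sup>2)\<bar>) has_integral 2 * (M u - m u)) {0..1}"
      by simp_all
  qed
  let ?\<mu> = "emeasure liouville (geodesics_meeting D)"
  define k :: "real \<Rightarrow> real \<Rightarrow> ennreal" where "k u t = ennreal \<bar>Re (d t / (p t - of_real u)\<^sup>2)\<bar>" for u t
  have k: "case_prod k \<in> borel_measurable (lborel \<Otimes>\<^sub>M lborel)"
    unfolding k_def by measurable
  have width: "2 * ?\<mu> = (\<integral>\<^sup>+u. ennreal (M u - m u) \<partial>lborel)"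
    unfolding emeasure_liouville_geodesics_meeting_doubled[OF D(3,1)] mM(2)
      nn_integral_inverse_square_pencil[OF mM(1)] ..
  have inner: "(\<integral>\<^sup>+t. k u t \<partial>lborel) = 2 * ennreal (M u - m u)" for u
  proof -
    have "((\<lambda>t. \<bar>Re (\<gamma>' t / (\<gamma> t - of_real u)\<^sup>2)\<bar>) has_integral 2 * (M u - m u)) A"
      unfolding A_def using has_integral_Diff_finite[OF S(1)] mM(3) by blast
    then have "(\<integral>\<^sup>+t. ennreal \<bar>Re (\<gamma>' t / (\<gamma> t - of_real u)\<^sup>2)\<bar> * indicator A t \<partial>lborel) = ennreal (2 * (M u - m u))"
      by (intro nn_integral_has_integral_lebesgue') auto
    also have "(\<lambda>t. ennreal \<bar>Re (\<gamma>' t / (\<gamma> t - of_real u)\<^sup>2)\<bar> * indicator A t) = k u"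
      using dp dp' by (auto simp: fun_eq_iff k_def indicator_def)
    finally show ?thesis using ennreal_mult'[of 2 "M u - m u"] by simp
  qed
  define q where "q t = cmod (d t) / Im (p t)" for t
  have q0: "0 \<le> q t" for t
  proof (cases "t \<in> A")
    case True
    show ?thesis unfolding q_def by (rule divide_nonneg_pos[OF norm_ge_zero dp'(3)[OF True]])
  qed (simp add: q_def dp)
  have q[measurable]: "q \<in> borel_measurable borel" unfolding q_def[abs_def] by measurable
  have outer: "(\<integral>\<^sup>+u. k u t \<partial>lborel) = 2 * ennreal (q t)" for t
  proof (cases "t \<in> A")
    case True
    then show ?thesis
      using nn_integral_abs_Re_divide_square[OF dp'(3)[OF True], of "d t"] q0[of t]
      by (simp add: k_def q_def ennreal_mult'[symmetric] numeral_mult_ennreal)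
  qed (simp add: k_def q_def dp)
  \<comment> \<open>Tonelli: integrating \<open>k\<close> over \<open>u\<close> first gives twice
    the length element, integrating over \<open>t\<close> first gives twice the width of the pencil
    coordinates.\<close>
  have "2 * (\<integral>\<^sup>+t. ennreal (q t) \<partial>lborel) = (\<integral>\<^sup>+t. \<integral>\<^sup>+u. k u t \<partial>lborel \<partial>lborel)"
    unfolding outer by (rule nn_integral_cmult[symmetric]) simp
  also have "\<dots> = (\<integral>\<^sup>+u. \<integral>\<^sup>+t. k u t \<partial>lborel \<partial>lborel)"
    by (rule lborel_pair.Fubini'[OF k])
  also have "\<dots> = 2 * (\<integral>\<^sup>+u. ennreal (M u - m u) \<partial>lborel)"
  proof -
    \<comment> \<open>Measurability of the width in \<open>u\<close> is read off from its being half
      of a partial integral of the jointly measurable \<open>k\<close>.\<close>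
    have "(\<lambda>u. \<integral>\<^sup>+t. k u t \<partial>lborel) \<in> borel_measurable lborel"
      using k by (rule lborel.borel_measurable_nn_integral)
    then have "(\<lambda>u. ennreal (1 / 2) * (\<integral>\<^sup>+t. k u t \<partial>lborel)) \<in> borel_measurable lborel" by measurable
    moreover have "ennreal (1 / 2) * (2 * ennreal x) = ennreal x" for x
    proof -
      have "ennreal (1 / 2) * 2 = ennreal (1 / 2) * ennreal 2" by simp
      also have "\<dots> = 1" by (subst ennreal_mult'[symmetric]) simp_all
      finally show ?thesis by (simp add: mult.assoc[symmetric])
    qed
    ultimately have "(\<lambda>u. ennreal (M u - m u)) \<in> borel_measurable lborel" unfolding inner by simp
    then show ?thesis unfolding inner by (rule nn_integral_cmult)
  qed
  finally have "2 * (\<integral>\<^sup>+t. ennreal (q t) \<partial>lborel) = 2 * (2 * ?\<mu>)" unfolding width .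
  then have Q: "(\<integral>\<^sup>+t. ennreal (q t) \<partial>lborel) = 2 * ?\<mu>"
    unfolding ennreal_mult_cancel_left by simp
  \<comment> \<open>Finiteness is what allows the extended nonnegative integral to be turned into a
    real-valued \<open>has_integral\<close> statement.\<close>
  have fin: "2 * ?\<mu> < \<infinity>"
    unfolding width by (rule nn_integral_pencil_width_finite[OF D(3,1) mM(1,2)])
  then obtain L where L: "L \<ge> 0" "2 * ?\<mu> = ennreal L" by (cases "2 * ?\<mu>") auto
  have "(q has_integral L) UNIV"
    by (rule nn_integral_has_integral[OF q q0]) (use Q L in auto)
  moreover have "q = (\<lambda>t. if t \<in> A then norm (vector_derivative \<gamma> (at t)) / Im (\<gamma> t) else 0)"
    using dp dp' by (auto simp: fun_eq_iff q_def \<gamma>'_def)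
  ultimately have "((\<lambda>t. norm (vector_derivative \<gamma> (at t)) / Im (\<gamma> t)) has_integral L) A"
    by (simp add: has_integral_restrict_UNIV)
  then have "((\<lambda>t. norm (vector_derivative \<gamma> (at t)) / Im (\<gamma> t)) has_integral L) {0..1}"
    unfolding A_def using has_integral_Diff_finite[OF S(1)] by blast
  moreover have "?\<mu> = ennreal (L / 2)"
  proof -
    have "2 * ?\<mu> = 2 * ennreal (L / 2)" using L by (simp add: numeral_mult_ennreal)
    then show ?thesis unfolding ennreal_mult_cancel_left by simp
  qed
  ultimately show thesis using that L by blast
qed

theorem corollary1:
  fixes D :: "complex set"
  assumes "D \<subseteq> upper_half_plane"
    and "compact D"
    and "interior D \<noteq> {}"
    and "geodesically_convex D"
    and "geodesic_polygon (frontier D) \<or> C1_loop (frontier D)"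
  shows "emeasure liouville (geodesics_meeting D) = ennreal (hyperbolic_length (frontier D) / 2)"
proof -
  obtain \<gamma> where \<gamma>: "parametrizes_loop \<gamma> (frontier D)"
    using assms(5) by (auto simp: geodesic_polygon_def C1_loop_def)
  obtain L where L: "L \<ge> 0" "emeasure liouville (geodesics_meeting D) = ennreal (L / 2)"
    and len: "((\<lambda>t. norm (vector_derivative \<gamma> (at t)) / Im (\<gamma> t)) has_integral L) {0..1}"
    using crofton_convex_loop[OF assms(1,4,2) \<gamma>] by blast
  \<comment> \<open>For any other parametrization the Crofton formula gives a nonnegative length
    with the same half, namely the measure of the geodesics meeting \<open>D\<close>; so the length
    does not depend on the parametrization.\<close>
  have "L' = L" if L': "has_hyperbolic_length (frontier D) L'" for L'
  proof -
    obtain \<beta> where \<beta>: "parametrizes_loop \<beta> (frontier D)"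
      "((\<lambda>t. norm (vector_derivative \<beta> (at t)) / Im (\<beta> t)) has_integral L') {0..1}"
      using L' by (auto simp: has_hyperbolic_length_def)
    obtain L'' where "L'' \<ge> 0" "emeasure liouville (geodesics_meeting D) = ennreal (L'' / 2)"
      "((\<lambda>t. norm (vector_derivative \<beta> (at t)) / Im (\<beta> t)) has_integral L'') {0..1}"
      using crofton_convex_loop[OF assms(1,4,2) \<beta>(1)] by blast
    then show ?thesis using \<beta>(2) L by (auto dest: has_integral_unique)
  qed
  moreover have "has_hyperbolic_length (frontier D) L"
    using \<gamma> len by (auto simp: has_hyperbolic_length_def)
  ultimately have "hyperbolic_length (frontier D) = L"
    unfolding hyperbolic_length_def by (intro the_equality)
  then show ?thesis using L by simp
qed

end
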